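(* Let $n\ge 1$ and $m\ge 0$ be integers, and let $(H,\langle-,-\rangle,L)$ be either the triple $(H_{n,m},\langle-,-\rangle,L)$ or, if $m\le 2n$, the triple $(H'_{n,m},\langle-,-\rangle,L)$ (both defined in the context). Then: (a) (Poincaré duality) For all $i\ge 0$, the bilinear pairing $\langle-,-\rangle: H^{i}\times H^{-i}\to\mathbb{R}$ is $S_n$-equivariant and non-degenerate. (b) (Hard Lefschetz) The operator $L:H^{i}\to H^{i+2}$ is $S_n$-equivariant, and for all $i\ge 0$ the map $L^{i}:H^{-i}\to H^{i}$ is an isomorphism. (c) (Hodge--Riemann relations) For all integers $0\le i\le m/2$, the Lefschetz form on $H^{-m+2i}$ defined by $(a,b)_L^{-m+2i}:=\langle a,L^{m-2i}b\rangle$ is $S_n$-equivariant, and its restriction to $P_L^{-m+2i}:=\ker(L^{m-2i+1})\cap H^{-m+2i}$ is $(-1)^{i-s}$-definite, where $s=0$ if $H=H_{n,m}$, and $s=\max(0,m-n)$ if $H=H'_{n,m}$.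
   Context: Polynomial case. Let $D=\mathbb{R}[d_1,\dots,d_n]$ and $R=\mathbb{R}[x_1,\dots,x_n]$ be polynomial rings with all variables of degree $1$, and let $D^i$, $R^j$ be the homogeneous pieces of degree $i$, $j$. Put $H_{n,m}=\bigoplus_{i=0}^m H_{n,m}^{-m+2i}$ with $H_{n,m}^{-m+2i}:=D^i\otimes R^{m-i}$ (all other graded pieces are $0$). The symmetric group $S_n$ acts on $D$ and $R$ by permuting the indices of the variables, hence diagonally on $H_{n,m}$. The pairing on $H_{n,m}$ is the bilinear extension of $\langle d\otimes f,d'\otimes f'\rangle:=(d,f')(d',f)$, where $(d,f)=(d\cdot f)(0)$ is obtained by letting $d$ act on $f$ as a differential operator with $d_k$ acting as $\partial/\partial x_k$, and evaluating at $x=0$. The operator is $L:=\sum_{k=1}^n d_k\otimes\frac{\partial}{\partial x_k}$, where $d_k$ acts by multiplication on $D$. Exterior case ($m\le 2n$). Let $V$ be a real vector space with basis $\theta_1,\dots,\theta_n$ and $V^*$ its dual with dual basis $\xi_1,\dots,\xi_n$. Let $\Lambda^i=\Lambda^i(V)$ and $(\Lambda^* )^j=\Lambda^j(V^* )$ be the exterior powers. Put $H'_{n,m}=\bigoplus_{i=0}^m (H'_{n,m})^{-m+2i}$ with $(H'_{n,m})^{-m+2i}:=\Lambda^i\otimes(\Lambda^* )^{m-i}$. $S_n$ acts by permuting the indices of the $\theta_k$ and of the $\xi_k$, hence on exterior powers and on $H'_{n,m}$. Let $(-,-):\Lambda^i\times(\Lambda^* )^j\to\mathbb{R}$ be the bilinear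 pairing with $(u_1\wedge\dots\wedge u_i,\,v_1^*\wedge\dots\wedge v_j^* )=\det(v_k^*(u_l))$ if $i=j$, and $0$ if $i\ne j$. The pairing on $H'_{n,m}$ is the bilinear extension of $\langle u\otimes v^*,u'\otimes (v^* )'\rangle:=(-1)^{\varepsilon}(u,(v^* )')(u',v^* )$, where $\varepsilon=m(m-1)/2$ if $0\le m\le n$ and $\varepsilon=(2n-m)(2n-m-1)/2$ if $n<m\le 2n$. The operator is $L:=\sum_{k=1}^n e_{\theta_k}\otimes i_{\theta_k}$, meaning $L(u\otimes v^* )=\sum_k (\theta_k\wedge u)\otimes i_{\theta_k}(v^* )$ (no extra sign), where $i_{\theta_k}$ is the interior product on $\Lambda(V^* )$: the degree $-1$ anti-derivation with $i_{\theta_k}(\alpha)=\alpha(\theta_k)$ for $\alpha\in V^*$, $i_{\theta_k}(\alpha\wedge\beta)=(i_{\theta_k}\alpha)\wedge\beta+(-1)^{\deg\alpha}\alpha\wedge i_{\theta_k}\beta$, and $i_{\theta_k}=0$ on scalars. A bilinear form is $S_n$-equivariant if it is $S_n$-invariant, i.e. $\langle\sigma a,\sigma b\rangle=\langle a,b\rangle$ for all $\sigma\in S_n$; a linear operator is $S_n$-equivariant if it commutes with $S_n$. A symmetric bilinear form is $(-1)^j$-definite if $(-1)^j$ times it is positive definite (vacuously true on the zero space). *)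

theory Defs
  imports
    "HOL-Analysis.Linear_Algebra"
    "HOL-Analysis.Finite_Function_Topology"
    "HOL-Combinatorics.Permutations"
    "Jordan_Normal_Form.Determinant"
begin

section \<open>Free vector spaces and their tensor products\<close>

text \<open>
  A real vector space with basis \<open>'a\<close> is represented by the type \<open>'a \<Rightarrow>\<^sub>0 real\<close> of finitely
  supported functions; the basis vector belonging to \<open>k\<close> is \<open>bvec k\<close>.
\<close>

abbreviation bvec :: "'a \<Rightarrow> 'a \<Rightarrow>\<^sub>0 real" where
  "bvec k \<equiv> Poly_Mapping.single k 1"

definition lin_ext :: "('a \<Rightarrow> 'b::real_vector) \<Rightarrow> ('a \<Rightarrow>\<^sub>0 real) \<Rightarrow> 'b" where
  "lin_ext f a = (\<Sum>k\<in>Poly_Mapping.keys a. Poly_Mapping.lookup a k *\<^sub>R f k)"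

definition bilin_ext ::
  "('a \<Rightarrow> 'b \<Rightarrow> 'c::real_vector) \<Rightarrow> ('a \<Rightarrow>\<^sub>0 real) \<Rightarrow> ('b \<Rightarrow>\<^sub>0 real) \<Rightarrow> 'c" where
  "bilin_ext B a b = lin_ext (\<lambda>k. lin_ext (B k) b) a"

text \<open>
  The tensor product of the spaces with bases \<open>'a\<close> and \<open>'b\<close> is the space with basis
  \<open>'a \<times> 'b\<close>; see \<open>tensor_universal\<close> below for the universal property.
\<close>

definition tensor :: "('a \<Rightarrow>\<^sub>0 real) \<Rightarrow> ('b \<Rightarrow>\<^sub>0 real) \<Rightarrow> ('a \<times> 'b) \<Rightarrow>\<^sub>0 real"
    (infixr \<open>\<otimes>\<^sub>t\<close> 75) where
  "u \<otimes>\<^sub>t v = bilin_ext (\<lambda>k l. bvec (k, l)) u v"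

definition tensor_map ::
  "(('a \<Rightarrow>\<^sub>0 real) \<Rightarrow> ('c \<Rightarrow>\<^sub>0 real)) \<Rightarrow> (('b \<Rightarrow>\<^sub>0 real) \<Rightarrow> ('d \<Rightarrow>\<^sub>0 real)) \<Rightarrow>
   (('a \<times> 'b) \<Rightarrow>\<^sub>0 real) \<Rightarrow> (('c \<times> 'd) \<Rightarrow>\<^sub>0 real)" where
  "tensor_map f g = lin_ext (\<lambda>(k, l). f (bvec k) \<otimes>\<^sub>t g (bvec l))"

text \<open>
  The bilinear extension of \<open>\<langle>u \<otimes> v, u' \<otimes> v'\<rangle> = \<beta> u v' * \<beta> u' v\<close>
  (see \<open>tensor_form_tensor\<close>).
\<close>

definition tensor_form ::
  "(('a \<Rightarrow>\<^sub>0 real) \<Rightarrow> ('b \<Rightarrow>\<^sub>0 real) \<Rightarrow> real) \<Rightarrow>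
   (('a \<times> 'b) \<Rightarrow>\<^sub>0 real) \<Rightarrow> (('a \<times> 'b) \<Rightarrow>\<^sub>0 real) \<Rightarrow> real" where
  "tensor_form \<beta> =
     bilin_ext (\<lambda>(k, l) (k', l'). \<beta> (bvec k) (bvec l') * \<beta> (bvec k') (bvec l))"

text \<open>
  The piece of degree \<open>d\<close> of the graded space whose piece of degree \<open>-m + 2i\<close> is
  \<open>A i \<otimes> B (m - i)\<close> for \<open>0 \<le> i \<le> m\<close>; all other pieces are \<open>span {} = {0}\<close>.
\<close>

definition graded_tensor ::
  "(nat \<Rightarrow> ('a \<Rightarrow>\<^sub>0 real) set) \<Rightarrow> (nat \<Rightarrow> ('b \<Rightarrow>\<^sub>0 real) set) \<Rightarrow> nat \<Rightarrow> int \<Rightarrow>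
   (('a \<times> 'b) \<Rightarrow>\<^sub>0 real) set" where
  "graded_tensor A B m d =
     span {u \<otimes>\<^sub>t v | u v i. i \<le> m \<and> d = - int m + 2 * int i \<and> u \<in> A i \<and> v \<in> B (m - i)}"


section \<open>The polynomial triple\<close>

text \<open>
  A monomial is its exponent vector. Both \<open>D\<close> and \<open>R\<close> are modelled by the same type; the
  variables in use are those with index in \<open>{1..n}\<close>.
\<close>

type_synonym rpoly = "(nat \<Rightarrow>\<^sub>0 nat) \<Rightarrow>\<^sub>0 real"

definition pvar :: "nat \<Rightarrow> rpoly" where
  "pvar k = bvec (Poly_Mapping.single k 1)"

definition poly_hom :: "nat \<Rightarrow> nat \<Rightarrow> rpoly set" where
  "poly_hom n i = {p. \<forall>\<alpha>\<in>Poly_Mapping.keys p. Poly_Mapping.keys \<alpha> \<subseteq> {1..n} \<and>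
     (\<Sum>k\<in>Poly_Mapping.keys \<alpha>. Poly_Mapping.lookup \<alpha> k) = i}"

definition pdiff :: "nat \<Rightarrow> rpoly \<Rightarrow> rpoly" where
  "pdiff k = lin_ext (\<lambda>\<alpha>. Poly_Mapping.single (\<alpha> - Poly_Mapping.single k 1)
     (real (Poly_Mapping.lookup \<alpha> k)))"

definition diff_monom :: "(nat \<Rightarrow>\<^sub>0 nat) \<Rightarrow> rpoly \<Rightarrow> rpoly" where
  "diff_monom \<alpha> f = foldr (\<lambda>k. pdiff k ^^ Poly_Mapping.lookup \<alpha> k)
     (sorted_list_of_set (Poly_Mapping.keys \<alpha>)) f"

definition diff_act :: "rpoly \<Rightarrow> rpoly \<Rightarrow> rpoly" where
  "diff_act d f = lin_ext (\<lambda>\<alpha>. diff_monom \<alpha> f) d"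

text \<open>The value of a polynomial at the origin is its constant coefficient.\<close>

definition poly_pair :: "rpoly \<Rightarrow> rpoly \<Rightarrow> real" where
  "poly_pair d f = Poly_Mapping.lookup (diff_act d f) 0"

definition poly_perm :: "(nat \<Rightarrow> nat) \<Rightarrow> rpoly \<Rightarrow> rpoly" where
  "poly_perm \<sigma> = lin_ext (\<lambda>\<alpha>. \<Prod>k\<in>Poly_Mapping.keys \<alpha>. pvar (\<sigma> k) ^ Poly_Mapping.lookup \<alpha> k)"

type_synonym poly_tensor = "((nat \<Rightarrow>\<^sub>0 nat) \<times> (nat \<Rightarrow>\<^sub>0 nat)) \<Rightarrow>\<^sub>0 real"

definition poly_H :: "nat \<Rightarrow> nat \<Rightarrow> int \<Rightarrow> poly_tensor set" where
  "poly_H n m = graded_tensor (poly_hom n) (poly_hom n) m"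

definition poly_act :: "(nat \<Rightarrow> nat) \<Rightarrow> poly_tensor \<Rightarrow> poly_tensor" where
  "poly_act \<sigma> = tensor_map (poly_perm \<sigma>) (poly_perm \<sigma>)"

definition poly_form :: "poly_tensor \<Rightarrow> poly_tensor \<Rightarrow> real" where
  "poly_form = tensor_form poly_pair"

definition poly_L :: "nat \<Rightarrow> poly_tensor \<Rightarrow> poly_tensor" where
  "poly_L n a = (\<Sum>k = 1..n. tensor_map (\<lambda>d. pvar k * d) (pdiff k) a)"


section \<open>The exterior triple\<close>

text \<open>
  The basis vector of a finite set \<open>S = {s\<^sub>1 < \<dots> < s\<^sub>r}\<close> stands for
  \<open>\<theta>\<^bsub>s\<^sub>1\<^esub> \<and> \<dots> \<and> \<theta>\<^bsub>s\<^sub>r\<^esub>\<close> in the exterior algebra of \<open>V\<close>, and for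
  \<open>\<xi>\<^bsub>s\<^sub>1\<^esub> \<and> \<dots> \<and> \<xi>\<^bsub>s\<^sub>r\<^esub>\<close> in that of the dual space; both are modelled by the same type.
\<close>

type_synonym ext = "nat set \<Rightarrow>\<^sub>0 real"

definition egen :: "nat \<Rightarrow> ext" where
  "egen k = bvec {k}"

definition ext_deg :: "nat \<Rightarrow> nat \<Rightarrow> ext set" where
  "ext_deg n i = {a. \<forall>S\<in>Poly_Mapping.keys a. S \<subseteq> {1..n} \<and> card S = i}"

definition inversions :: "nat set \<Rightarrow> nat set \<Rightarrow> (nat \<times> nat) set" where
  "inversions S T = {(s, t). s \<in> S \<and> t \<in> T \<and> t < s}"

text \<open>The sign is that of the permutation sorting the concatenation of \<open>S\<close> and \<open>T\<close>.\<close>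

definition wedge :: "ext \<Rightarrow> ext \<Rightarrow> ext" where
  "wedge = bilin_ext (\<lambda>S T. if S \<inter> T = {}
     then Poly_Mapping.single (S \<union> T) ((-1) ^ card (inversions S T)) else 0)"

definition wedge_list :: "ext list \<Rightarrow> ext" where
  "wedge_list us = foldr wedge us (bvec {})"

text \<open>
  \<open>int_prod k\<close> is contraction with \<open>\<theta>\<^sub>k\<close> on the exterior algebra of the dual space; it is
  determined by the lemmas \<open>int_prod_scalar\<close>, \<open>int_prod_egen\<close> and \<open>int_prod_wedge\<close>.
\<close>

definition int_prod :: "nat \<Rightarrow> ext \<Rightarrow> ext" where
  "int_prod k = lin_ext (\<lambda>S. if k \<in> S
     then Poly_Mapping.single (S - {k}) ((-1) ^ card {t \<in> S. t < k}) else 0)"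

text \<open>
  The determinant formula on basis elements: entry \<open>(k, l)\<close> is the \<open>k\<close>-th factor of
  \<open>\<xi>\<^sub>T\<close> evaluated at the \<open>l\<close>-th factor of \<open>\<theta>\<^sub>S\<close>. The formula for arbitrary
  vectors and covectors is \<open>ext_pair_wedge_list\<close>.
\<close>

definition ext_pair :: "ext \<Rightarrow> ext \<Rightarrow> real" where
  "ext_pair = bilin_ext (\<lambda>S T. if card S = card T
     then Determinant.det (Matrix.mat (card T) (card S) (\<lambda>(k, l).
       if sorted_list_of_set T ! k = sorted_list_of_set S ! l then 1 else 0))
     else 0)"

definition ext_perm :: "(nat \<Rightarrow> nat) \<Rightarrow> ext \<Rightarrow> ext" where
  "ext_perm \<sigma> = lin_ext (\<lambda>S. wedge_list (map (\<lambda>k. egen (\<sigma> k)) (sorted_list_of_set S)))"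

type_synonym ext_tensor = "(nat set \<times> nat set) \<Rightarrow>\<^sub>0 real"

definition ext_H :: "nat \<Rightarrow> nat \<Rightarrow> int \<Rightarrow> ext_tensor set" where
  "ext_H n m = graded_tensor (ext_deg n) (ext_deg n) m"

definition ext_act :: "(nat \<Rightarrow> nat) \<Rightarrow> ext_tensor \<Rightarrow> ext_tensor" where
  "ext_act \<sigma> = tensor_map (ext_perm \<sigma>) (ext_perm \<sigma>)"

definition ext_form :: "nat \<Rightarrow> nat \<Rightarrow> ext_tensor \<Rightarrow> ext_tensor \<Rightarrow> real" where
  "ext_form n m a b =
     (-1) ^ (if m \<le> n then m * (m - 1) div 2 else (2 * n - m) * (2 * n - m - 1) div 2)
     * tensor_form ext_pair a b"

definition ext_L :: "nat \<Rightarrow> ext_tensor \<Rightarrow> ext_tensor" where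
  "ext_L n a = (\<Sum>k = 1..n. tensor_map (wedge (egen k)) (int_prod k) a)"


section \<open>Poincare duality, hard Lefschetz and Hodge--Riemann\<close>

text \<open>
  In the following, \<open>H d\<close> is the piece of degree \<open>d\<close> of a graded real vector space,
  \<open>act \<sigma>\<close> the action of a permutation \<open>\<sigma>\<close> of \<open>{1..n}\<close>, \<open>form\<close> a pairing and
  \<open>L\<close> an operator.
\<close>

definition invariant_form_on ::
  "nat \<Rightarrow> ((nat \<Rightarrow> nat) \<Rightarrow> 'a \<Rightarrow> 'a) \<Rightarrow> 'a set \<Rightarrow> 'a set \<Rightarrow> ('a \<Rightarrow> 'a \<Rightarrow> real) \<Rightarrow> bool" where
  "invariant_form_on n act U V form \<longleftrightarrow>
     (\<forall>\<sigma>. \<sigma> permutes {1..n} \<longrightarrow> (\<forall>a\<in>U. \<forall>b\<in>V. form (act \<sigma> a) (act \<sigma> b) = form a b))"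

definition equivariant_map_on ::
  "nat \<Rightarrow> ((nat \<Rightarrow> nat) \<Rightarrow> 'a \<Rightarrow> 'a) \<Rightarrow> 'a set \<Rightarrow> ('a \<Rightarrow> 'a) \<Rightarrow> bool" where
  "equivariant_map_on n act U f \<longleftrightarrow>
     (\<forall>\<sigma>. \<sigma> permutes {1..n} \<longrightarrow> (\<forall>a\<in>U. f (act \<sigma> a) = act \<sigma> (f a)))"

definition nondegenerate_on ::
  "'a::zero set \<Rightarrow> 'a set \<Rightarrow> ('a \<Rightarrow> 'a \<Rightarrow> real) \<Rightarrow> bool" where
  "nondegenerate_on U V form \<longleftrightarrow>
     (\<forall>a\<in>U. (\<forall>b\<in>V. form a b = 0) \<longrightarrow> a = 0) \<and>
     (\<forall>b\<in>V. (\<forall>a\<in>U. form a b = 0) \<longrightarrow> b = 0)"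

definition signed_definite_on ::
  "real \<Rightarrow> 'a::zero set \<Rightarrow> ('a \<Rightarrow> 'a \<Rightarrow> real) \<Rightarrow> bool" where
  "signed_definite_on \<epsilon> U form \<longleftrightarrow>
     (\<forall>a\<in>U. \<forall>b\<in>U. form a b = form b a) \<and> (\<forall>a\<in>U. a \<noteq> 0 \<longrightarrow> \<epsilon> * form a a > 0)"

definition poincare_duality ::
  "nat \<Rightarrow> (int \<Rightarrow> 'a::real_vector set) \<Rightarrow> ((nat \<Rightarrow> nat) \<Rightarrow> 'a \<Rightarrow> 'a) \<Rightarrow> ('a \<Rightarrow> 'a \<Rightarrow> real) \<Rightarrow> bool"
  where
  "poincare_duality n H act form \<longleftrightarrow> bilinear form \<and>
     (\<forall>i\<ge>0. invariant_form_on n act (H i) (H (- i)) form \<and>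
             nondegenerate_on (H i) (H (- i)) form)"

definition hard_lefschetz ::
  "nat \<Rightarrow> (int \<Rightarrow> 'a::real_vector set) \<Rightarrow> ((nat \<Rightarrow> nat) \<Rightarrow> 'a \<Rightarrow> 'a) \<Rightarrow> ('a \<Rightarrow> 'a) \<Rightarrow> bool" where
  "hard_lefschetz n H act L \<longleftrightarrow> linear L \<and>
     (\<forall>i. L ` H i \<subseteq> H (i + 2) \<and> equivariant_map_on n act (H i) L) \<and>
     (\<forall>i::nat. bij_betw (L ^^ i) (H (- int i)) (H (int i)))"

definition lefschetz_form ::
  "('a \<Rightarrow> 'a \<Rightarrow> real) \<Rightarrow> ('a \<Rightarrow> 'a) \<Rightarrow> nat \<Rightarrow> 'a \<Rightarrow> 'a \<Rightarrow> real" where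
  "lefschetz_form form L r a b = form a ((L ^^ r) b)"

definition primitive_part :: "('a::zero \<Rightarrow> 'a) \<Rightarrow> nat \<Rightarrow> 'a set \<Rightarrow> 'a set" where
  "primitive_part L r U = {a \<in> U. (L ^^ (r + 1)) a = 0}"

definition hodge_riemann ::
  "nat \<Rightarrow> nat \<Rightarrow> int \<Rightarrow> (int \<Rightarrow> 'a::real_vector set) \<Rightarrow> ((nat \<Rightarrow> nat) \<Rightarrow> 'a \<Rightarrow> 'a) \<Rightarrow>
   ('a \<Rightarrow> 'a \<Rightarrow> real) \<Rightarrow> ('a \<Rightarrow> 'a) \<Rightarrow> bool" where
  "hodge_riemann n m s H act form L \<longleftrightarrow>
     (\<forall>i::nat. 2 * i \<le> m \<longrightarrow>
        (let d = - int m + 2 * int i; r = m - 2 * i in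
           invariant_form_on n act (H d) (H d) (lefschetz_form form L r) \<and>
           signed_definite_on ((-1) powi (int i - s)) (primitive_part L r (H d))
             (lefschetz_form form L r)))"


section \<open>Basic properties of the definitions\<close>

lemma lin_ext_superset:
  assumes "finite K" "Poly_Mapping.keys a \<subseteq> K"
  shows "lin_ext f a = (\<Sum>k\<in>K. Poly_Mapping.lookup a k *\<^sub>R f k)"
  unfolding lin_ext_def using assms
  by (intro sum.mono_neutral_left) (auto simp: in_keys_iff)

lemma lookup_scaleR [simp]:
  "Poly_Mapping.lookup (c *\<^sub>R a) k = c *\<^sub>R Poly_Mapping.lookup a k"
proof -
  have "finite {i. c *\<^sub>R Poly_Mapping.lookup a i \<noteq> 0}"
    by (rule finite_subset[OF _ finite_keys[of a]]) (auto simp: in_keys_iff)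
  then show ?thesis
    by (simp add: scaleR_poly_mapping_def Abs_poly_mapping_inverse)
qed

lemma linear_lin_ext: "linear (lin_ext f)"
proof (rule linearI)
  fix a b :: "'a \<Rightarrow>\<^sub>0 real" and c :: real
  let ?K = "Poly_Mapping.keys a \<union> Poly_Mapping.keys b"
  have "lin_ext f (a + b) = (\<Sum>k\<in>?K. Poly_Mapping.lookup (a + b) k *\<^sub>R f k)"
    by (rule lin_ext_superset) (auto simp: keys_add)
  also have "\<dots> = (\<Sum>k\<in>?K. Poly_Mapping.lookup a k *\<^sub>R f k)
      + (\<Sum>k\<in>?K. Poly_Mapping.lookup b k *\<^sub>R f k)"
    by (simp add: lookup_add scaleR_add_left sum.distrib)
  finally show "lin_ext f (a + b) = lin_ext f a + lin_ext f b"
    by (simp add: lin_ext_superset[of ?K])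
  have "lin_ext f (c *\<^sub>R a)
      = (\<Sum>k\<in>Poly_Mapping.keys a. Poly_Mapping.lookup (c *\<^sub>R a) k *\<^sub>R f k)"
    by (rule lin_ext_superset) (auto simp: in_keys_iff)
  then show "lin_ext f (c *\<^sub>R a) = c *\<^sub>R lin_ext f a"
    by (simp add: lin_ext_def scaleR_sum_right)
qed

lemma lin_ext_single [simp]: "lin_ext f (Poly_Mapping.single k c) = c *\<^sub>R f k"
  by (simp add: lin_ext_def)

lemma bvec_expansion: "lin_ext bvec a = a"
proof (rule poly_mapping_eqI)
  fix k
  have "Poly_Mapping.lookup (lin_ext bvec a) k =
      (\<Sum>l\<in>Poly_Mapping.keys a. if l = k then Poly_Mapping.lookup a l else 0)"
    unfolding lin_ext_def lookup_sum
    by (rule sum.cong) (auto simp: lookup_single when_def)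
  also have "\<dots> = Poly_Mapping.lookup a k"
    by (auto simp: in_keys_iff)
  finally show "Poly_Mapping.lookup (lin_ext bvec a) k = Poly_Mapping.lookup a k" .
qed

lemma linear_eq_lin_ext:
  assumes "linear f"
  shows "f a = lin_ext (\<lambda>k. f (bvec k)) a"
proof -
  have "f a = f (lin_ext bvec a)"
    by (simp add: bvec_expansion)
  also have "\<dots> = lin_ext (\<lambda>k. f (bvec k)) a"
    using assms by (simp add: lin_ext_def linear_sum linear_scale)
  finally show ?thesis .
qed

lemma linear_eq_on_keys:
  assumes "linear f" "linear g" "\<And>k. k \<in> Poly_Mapping.keys a \<Longrightarrow> f (bvec k) = g (bvec k)"
  shows "f a = g a"
proof -
  have "lin_ext (\<lambda>k. f (bvec k)) a = lin_ext (\<lambda>k. g (bvec k)) a"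
    unfolding lin_ext_def using assms(3) by (intro sum.cong) auto
  then show ?thesis
    by (metis assms(1,2) linear_eq_lin_ext)
qed

lemma bilinear_bilin_ext: "bilinear (bilin_ext B)"
proof -
  have l: "linear (\<lambda>b. lin_ext (\<lambda>k. lin_ext (B k) b) a)" for a
    unfolding lin_ext_def[of _ a]
    by (intro linear_compose_sum ballI linear_compose_scale_right linear_lin_ext)
  show ?thesis
    unfolding bilinear_def bilin_ext_def by (simp add: linear_lin_ext l)
qed

lemma bilin_ext_single [simp]:
  "bilin_ext B (Poly_Mapping.single k c) (Poly_Mapping.single l d) = c *\<^sub>R d *\<^sub>R B k l"
  by (simp add: bilin_ext_def)

lemma bilinear_linear: "bilinear B \<Longrightarrow> linear (B u)" "bilinear B \<Longrightarrow> linear (\<lambda>u. B u v)"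
  by (auto simp: bilinear_def)

lemma bilinear_eq_on_keys:
  assumes "bilinear f" "bilinear g"
    and "\<And>k l. k \<in> Poly_Mapping.keys a \<Longrightarrow> l \<in> Poly_Mapping.keys b \<Longrightarrow>
      f (bvec k) (bvec l) = g (bvec k) (bvec l)"
  shows "f a b = g a b"
proof -
  note lin = assms(1,2)[THEN bilinear_linear(1)] assms(1,2)[THEN bilinear_linear(2)]
  have "f (bvec k) b = g (bvec k) b" if "k \<in> Poly_Mapping.keys a" for k
    by (rule linear_eq_on_keys[OF lin(1) lin(2)]) (rule assms(3)[OF that])
  then show ?thesis
    by (rule linear_eq_on_keys[OF lin(3) lin(4)])
qed

lemma bilinear_linear_compose:
  "bilinear B \<Longrightarrow> linear f \<Longrightarrow> bilinear (\<lambda>u v. f (B u v))"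
  by (auto simp: bilinear_def linear_iff)

lemma bilinear_compose2:
  "bilinear B \<Longrightarrow> linear f \<Longrightarrow> linear g \<Longrightarrow> bilinear (\<lambda>u v. B (f u) (g v))"
  by (auto simp: bilinear_def linear_iff)

lemma bilinear_swap: "bilinear B \<Longrightarrow> bilinear (\<lambda>u v. B v u)"
  by (auto simp: bilinear_def)

lemma bilinear_real_mult: "bilinear ((*) :: real \<Rightarrow> real \<Rightarrow> real)"
  by (auto simp: bilinear_def linear_iff algebra_simps)

lemma linear_lookup: "linear (\<lambda>a::'a \<Rightarrow>\<^sub>0 real. Poly_Mapping.lookup a k)"
  by (auto simp: linear_iff lookup_add)

lemma bilinear_tensor: "bilinear (\<otimes>\<^sub>t)"
  using bilinear_bilin_ext by (simp add: tensor_def[abs_def])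

lemma tensor_bvec [simp]: "bvec k \<otimes>\<^sub>t bvec l = bvec (k, l)"
  by (simp add: tensor_def)

lemma lookup_tensor:
  "Poly_Mapping.lookup (u \<otimes>\<^sub>t v) (k, l) = Poly_Mapping.lookup u k * Poly_Mapping.lookup v l"
  by (rule bilinear_eq_on_keys[OF
        bilinear_linear_compose[OF bilinear_tensor linear_lookup]
        bilinear_compose2[OF bilinear_real_mult linear_lookup linear_lookup]])
     (auto simp: lookup_single when_def)

lemma tensor_universal:
  fixes B :: "('a \<Rightarrow>\<^sub>0 real) \<Rightarrow> ('b \<Rightarrow>\<^sub>0 real) \<Rightarrow> 'c::real_vector"
  assumes "bilinear B"
  shows "\<exists>!f. linear f \<and> (\<forall>u v. f (u \<otimes>\<^sub>t v) = B u v)"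
proof (rule ex1I[of _ "lin_ext (\<lambda>(k, l). B (bvec k) (bvec l))"])
  let ?f = "lin_ext (\<lambda>(k, l). B (bvec k) (bvec l))"
  have "?f (u \<otimes>\<^sub>t v) = B u v" for u v
    by (rule bilinear_eq_on_keys[OF
          bilinear_linear_compose[OF bilinear_tensor linear_lin_ext] assms]) simp
  then show "linear ?f \<and> (\<forall>u v. ?f (u \<otimes>\<^sub>t v) = B u v)"
    by (simp add: linear_lin_ext)
next
  fix f :: "('a \<times> 'b \<Rightarrow>\<^sub>0 real) \<Rightarrow> 'c"
  assume f: "linear f \<and> (\<forall>u v. f (u \<otimes>\<^sub>t v) = B u v)"
  have "f (bvec (k, l)) = B (bvec k) (bvec l)" for k l
    using f tensor_bvec[of k l] by metis
  then have eq: "(\<lambda>p. f (bvec p)) = (\<lambda>(k, l). B (bvec k) (bvec l))"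
    by auto
  have "f a = lin_ext (\<lambda>(k, l). B (bvec k) (bvec l)) a" for a
    by (metis eq f linear_eq_lin_ext)
  then show "f = lin_ext (\<lambda>(k, l). B (bvec k) (bvec l))"
    by (rule HOL.ext)
qed

lemma tensor_map_tensor:
  assumes "linear f" "linear g"
  shows "tensor_map f g (u \<otimes>\<^sub>t v) = f u \<otimes>\<^sub>t g v"
  unfolding tensor_map_def
  by (rule bilinear_eq_on_keys[OF
        bilinear_linear_compose[OF bilinear_tensor linear_lin_ext]
        bilinear_compose2[OF bilinear_tensor assms]]) simp

lemma linear_tensor_map: "linear (tensor_map f g)"
  by (simp add: tensor_map_def linear_lin_ext)

lemma bilinear_tensor_form: "bilinear (tensor_form \<beta>)"
  by (simp add: tensor_form_def bilinear_bilin_ext)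

lemma tensor_form_tensor:
  assumes "bilinear \<beta>"
  shows "tensor_form \<beta> (u \<otimes>\<^sub>t v) (u' \<otimes>\<^sub>t v') = \<beta> u v' * \<beta> u' v"
proof -
  note lin = bilinear_linear[OF bilinear_tensor_form] bilinear_linear[OF assms]
  have 1: "tensor_form \<beta> (bvec k \<otimes>\<^sub>t bvec l) (u' \<otimes>\<^sub>t v') = \<beta> u' (bvec l) * \<beta> (bvec k) v'" for k l
    by (rule bilinear_eq_on_keys[OF bilinear_linear_compose[OF bilinear_tensor lin(1)]
          bilinear_compose2[OF bilinear_real_mult lin(4) lin(3)]])
       (simp add: tensor_form_def)
  have "tensor_form \<beta> (u \<otimes>\<^sub>t v) (u' \<otimes>\<^sub>t v') = \<beta> u v' * \<beta> u' v"
    by (rule bilinear_eq_on_keys[OF bilinear_linear_compose[OF bilinear_tensor lin(2)]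
          bilinear_compose2[OF bilinear_real_mult lin(4) lin(3)]])
       (simp only: 1 mult.commute)
  then show ?thesis .
qed

lemma graded_tensor_piece:
  assumes "i \<le> m"
  shows "graded_tensor A B m (- int m + 2 * int i)
    = span {u \<otimes>\<^sub>t v | u v. u \<in> A i \<and> v \<in> B (m - i)}"
  unfolding graded_tensor_def by (rule arg_cong[of _ _ span]) (use assms in auto)

lemma graded_tensor_zero:
  assumes "\<And>i. i \<le> m \<Longrightarrow> d \<noteq> - int m + 2 * int i"
  shows "graded_tensor A B m d = {0}"
proof -
  have "{u \<otimes>\<^sub>t v | u v i. i \<le> m \<and> d = - int m + 2 * int i \<and> u \<in> A i \<and> v \<in> B (m - i)} = {}"
    using assms by blast
  then show ?thesis
    unfolding graded_tensor_def by (simp only: span_empty)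
qed

lemma scaleR_eq_times: "c *\<^sub>R p = Poly_Mapping.single 0 c * (p :: rpoly)"
proof -
  have "c *\<^sub>R p = Poly_Mapping.map ((*) c) p"
    by (rule poly_mapping_eqI) (simp add: Poly_Mapping.map.rep_eq when_def)
  then show ?thesis
    by (simp add: mult_map_scale_conv_mult)
qed

lemma scaleR_single: "c *\<^sub>R Poly_Mapping.single k (d::real) = Poly_Mapping.single k (c * d)"
  by (rule poly_mapping_eqI) (simp add: lookup_single when_def)

lemma bilinear_poly_mult: "bilinear ((*) :: rpoly \<Rightarrow> rpoly \<Rightarrow> rpoly)"
  unfolding bilinear_def linear_iff
  by (simp add: scaleR_eq_times algebra_simps)

lemma linear_pdiff: "linear (pdiff k)"
  by (simp add: pdiff_def linear_lin_ext)

lemma pdiff_one: "pdiff k 1 = 0"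
  by (simp add: pdiff_def flip: single_one)

lemma pdiff_pvar: "pdiff k (pvar l) = (if k = l then 1 else 0)"
  by (simp add: pdiff_def pvar_def lookup_single when_def flip: single_one)

lemma pdiff_mult: "pdiff k (p * q) = pdiff k p * q + p * pdiff k q"
proof (rule bilinear_eq_on_keys[of "\<lambda>p q. pdiff k (p * q)" "\<lambda>p q. pdiff k p * q + p * pdiff k q"])
  show "bilinear (\<lambda>p q. pdiff k (p * q))"
    by (rule bilinear_linear_compose[OF bilinear_poly_mult linear_pdiff])
  show "bilinear (\<lambda>p q. pdiff k p * q + p * pdiff k q)"
    using bilinear_poly_mult linear_pdiff[of k] unfolding bilinear_def linear_iff
    by (simp add: algebra_simps)
  fix \<alpha> \<beta> :: "nat \<Rightarrow>\<^sub>0 nat"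
  let ?e = "Poly_Mapping.single k (1::nat)"
  have 1: "\<alpha> - ?e + \<beta> = \<alpha> + \<beta> - ?e" if "Poly_Mapping.lookup \<alpha> k \<noteq> 0" for \<alpha> \<beta> :: "nat \<Rightarrow>\<^sub>0 nat"
    using that by (intro poly_mapping_eqI) (auto simp: lookup_add lookup_minus lookup_single when_def)
  have 2: "Poly_Mapping.single (\<alpha> - ?e + \<beta>) (real (Poly_Mapping.lookup \<alpha> k))
      = Poly_Mapping.single (\<alpha> + \<beta> - ?e) (real (Poly_Mapping.lookup \<alpha> k))"
    for \<alpha> \<beta> :: "nat \<Rightarrow>\<^sub>0 nat"
    using 1[of \<alpha> \<beta>] by (cases "Poly_Mapping.lookup \<alpha> k = 0") simp_all
  have "pdiff k (bvec \<alpha> * bvec \<beta>) = Poly_Mapping.single (\<alpha> + \<beta> - ?e)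
      (real (Poly_Mapping.lookup \<alpha> k) + real (Poly_Mapping.lookup \<beta> k))"
    by (simp add: pdiff_def mult_single lookup_add)
  also have "\<dots> = Poly_Mapping.single (\<alpha> - ?e + \<beta>) (real (Poly_Mapping.lookup \<alpha> k))
      + Poly_Mapping.single (\<beta> - ?e + \<alpha>) (real (Poly_Mapping.lookup \<beta> k))"
    unfolding 2 by (simp add: single_add add.commute)
  also have "\<dots> = pdiff k (bvec \<alpha>) * bvec \<beta> + bvec \<alpha> * pdiff k (bvec \<beta>)"
    by (simp add: pdiff_def mult_single add.commute)
  finally show "pdiff k (bvec \<alpha> * bvec \<beta>) = pdiff k (bvec \<alpha>) * bvec \<beta> + bvec \<alpha> * pdiff k (bvec \<beta>)" .
qed

lemma pdiff_commute: "pdiff k (pdiff l p) = pdiff l (pdiff k p)"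
proof (rule linear_eq_on_keys[of "\<lambda>p. pdiff k (pdiff l p)" "\<lambda>p. pdiff l (pdiff k p)"])
  show "linear (\<lambda>p. pdiff k (pdiff l p))" "linear (\<lambda>p. pdiff l (pdiff k p))"
    using linear_pdiff by (auto simp: linear_iff)
  fix \<alpha> :: "nat \<Rightarrow>\<^sub>0 nat"
  have "\<alpha> - Poly_Mapping.single l (1::nat) - Poly_Mapping.single k 1
      = \<alpha> - Poly_Mapping.single k 1 - Poly_Mapping.single l 1"
    by (rule poly_mapping_eqI) (simp add: lookup_minus)
  then show "pdiff k (pdiff l (bvec \<alpha>)) = pdiff l (pdiff k (bvec \<alpha>))"
    by (cases "k = l")
      (auto simp: pdiff_def lookup_minus lookup_single when_def scaleR_single mult.commute)
qed

lemma linear_funpow: "linear f \<Longrightarrow> linear (f ^^ i)" for f :: "'a::real_vector \<Rightarrow> 'a"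
  by (induction i) (auto simp: linear_iff)

lemma funpow_commute: "(\<And>x. f (g x) = g (f x)) \<Longrightarrow> (f ^^ i) ((g ^^ j) x) = (g ^^ j) ((f ^^ i) x)"
proof (induction i)
  case (Suc i)
  have "f ((g ^^ j) y) = (g ^^ j) (f y)" for y
    using Suc.prems by (induction j) simp_all
  with Suc show ?case
    by simp
qed simp

lemma foldr_pdiff_funpow_commute:
  "(pdiff l ^^ j) (foldr (\<lambda>k. pdiff k ^^ a k) ks f) = foldr (\<lambda>k. pdiff k ^^ a k) ks ((pdiff l ^^ j) f)"
proof (induction ks)
  case (Cons k ks)
  have "(pdiff l ^^ j) ((pdiff k ^^ a k) g) = (pdiff k ^^ a k) ((pdiff l ^^ j) g)" for g
    by (rule funpow_commute) (rule pdiff_commute)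
  with Cons show ?case
    by simp
qed simp

lemma foldr_pdiff_add:
  "foldr (\<lambda>k. pdiff k ^^ (a k + b k)) ks f
    = foldr (\<lambda>k. pdiff k ^^ a k) ks (foldr (\<lambda>k. pdiff k ^^ b k) ks f)"
  by (induction ks) (simp_all add: funpow_add foldr_pdiff_funpow_commute)

lemma diff_monom_superset:
  assumes "finite K" "Poly_Mapping.keys \<alpha> \<subseteq> K"
  shows "diff_monom \<alpha> f
    = foldr (\<lambda>k. pdiff k ^^ Poly_Mapping.lookup \<alpha> k) (sorted_list_of_set K) f"
proof -
  let ?P = "\<lambda>k. k \<in> Poly_Mapping.keys \<alpha>"
  have "sorted_list_of_set (Poly_Mapping.keys \<alpha>) = filter ?P (sorted_list_of_set K)"
    using assms by (intro sorted_distinct_set_unique) (auto intro: sorted_wrt_filter distinct_filter)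
  moreover have "foldr (\<lambda>k. pdiff k ^^ Poly_Mapping.lookup \<alpha> k) (filter ?P ks) f
      = foldr (\<lambda>k. pdiff k ^^ Poly_Mapping.lookup \<alpha> k) ks f" for ks
    by (induction ks) (auto simp: in_keys_iff)
  ultimately show ?thesis
    by (simp add: diff_monom_def)
qed

lemma diff_monom_add: "diff_monom (\<alpha> + \<beta>) f = diff_monom \<alpha> (diff_monom \<beta> f)"
proof -
  let ?K = "Poly_Mapping.keys \<alpha> \<union> Poly_Mapping.keys \<beta>"
  have "diff_monom (\<alpha> + \<beta>) f
      = foldr (\<lambda>k. pdiff k ^^ Poly_Mapping.lookup (\<alpha> + \<beta>) k) (sorted_list_of_set ?K) f"
    by (rule diff_monom_superset) (auto simp: keys_add)
  then show ?thesis
    by (simp add: lookup_add foldr_pdiff_add diff_monom_superset[of ?K \<alpha>] diff_monom_superset[of ?K \<beta>])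
qed

lemma linear_diff_monom: "linear (diff_monom \<alpha>)"
proof -
  have "linear (foldr (\<lambda>k. pdiff k ^^ a k) ks)" for a ks
  proof (induction ks)
    case (Cons k ks)
    then show ?case
      using linear_funpow[OF linear_pdiff, of "a k" k] by (auto simp: linear_iff)
  qed (simp add: linear_iff)
  then show ?thesis
    by (simp add: diff_monom_def[abs_def])
qed

lemma bilinear_diff_act: "bilinear diff_act"
proof -
  have "linear (\<lambda>f. diff_act d f)" for d
    unfolding diff_act_def lin_ext_def
    by (intro linear_compose_sum ballI linear_compose_scale_right linear_diff_monom)
  moreover have "linear (\<lambda>d. diff_act d f)" for f
    unfolding diff_act_def by (rule linear_lin_ext)
  ultimately show ?thesis
    by (simp add: bilinear_def)
qed

text \<open>
  \<open>diff_act\<close> makes the polynomial ring \<open>R\<close> a module over \<open>D\<close> in which the \<open>k\<close>-th variable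
  acts as \<open>\<partial>/\<partial>x\<^sub>k\<close>.
\<close>

lemma diff_act_one: "diff_act 1 f = f"
  by (simp add: diff_act_def diff_monom_def flip: single_one)

lemma diff_act_pvar: "diff_act (pvar k) f = pdiff k f"
  by (simp add: diff_act_def diff_monom_def pvar_def)

lemma diff_act_mult: "diff_act (d * d') f = diff_act d (diff_act d' f)"
proof (rule bilinear_eq_on_keys[of "\<lambda>d d'. diff_act (d * d') f" "\<lambda>d d'. diff_act d (diff_act d' f)"])
  show "bilinear (\<lambda>d d'. diff_act (d * d') f)"
    by (rule bilinear_linear_compose[OF bilinear_poly_mult bilinear_linear(2)[OF bilinear_diff_act]])
  show "bilinear (\<lambda>d d'. diff_act d (diff_act d' f))"
    using bilinear_compose2[OF bilinear_diff_act linear_id bilinear_linear(2)[OF bilinear_diff_act]]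
    by simp
qed (simp add: diff_act_def mult_single diff_monom_add)

lemma bilinear_poly_pair: "bilinear poly_pair"
  unfolding poly_pair_def by (rule bilinear_linear_compose[OF bilinear_diff_act linear_lookup])

lemma linear_poly_perm: "linear (poly_perm \<sigma>)"
  by (simp add: poly_perm_def linear_lin_ext)

text \<open>\<open>poly_perm \<sigma>\<close> is the algebra endomorphism sending the \<open>k\<close>-th variable to the \<open>\<sigma> k\<close>-th.\<close>

lemma poly_perm_one: "poly_perm \<sigma> 1 = 1"
  by (simp add: poly_perm_def flip: single_one)

lemma poly_perm_pvar: "poly_perm \<sigma> (pvar k) = pvar (\<sigma> k)"
  by (simp add: poly_perm_def pvar_def)

lemma poly_perm_mult: "poly_perm \<sigma> (p * q) = poly_perm \<sigma> p * poly_perm \<sigma> q"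
proof (rule bilinear_eq_on_keys[of "\<lambda>p q. poly_perm \<sigma> (p * q)" "\<lambda>p q. poly_perm \<sigma> p * poly_perm \<sigma> q"])
  show "bilinear (\<lambda>p q. poly_perm \<sigma> (p * q))"
    by (rule bilinear_linear_compose[OF bilinear_poly_mult linear_poly_perm])
  show "bilinear (\<lambda>p q. poly_perm \<sigma> p * poly_perm \<sigma> q)"
    by (rule bilinear_compose2[OF bilinear_poly_mult linear_poly_perm linear_poly_perm])
  fix \<alpha> \<beta> :: "nat \<Rightarrow>\<^sub>0 nat"
  let ?K = "Poly_Mapping.keys \<alpha> \<union> Poly_Mapping.keys \<beta>"
  have *: "poly_perm \<sigma> (bvec \<gamma>) = (\<Prod>k\<in>?K. pvar (\<sigma> k) ^ Poly_Mapping.lookup \<gamma> k)"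
    if "Poly_Mapping.keys \<gamma> \<subseteq> ?K" for \<gamma>
    unfolding poly_perm_def using that
    by simp (intro prod.mono_neutral_left, auto simp: in_keys_iff)
  have "Poly_Mapping.keys (\<alpha> + \<beta>) \<subseteq> ?K"
    by (rule keys_add)
  then show "poly_perm \<sigma> (bvec \<alpha> * bvec \<beta>) = poly_perm \<sigma> (bvec \<alpha>) * poly_perm \<sigma> (bvec \<beta>)"
    by (simp add: mult_single * lookup_add power_add prod.distrib)
qed

lemma poly_form_tensor:
  "poly_form (d \<otimes>\<^sub>t f) (d' \<otimes>\<^sub>t f') = poly_pair d f' * poly_pair d' f"
  by (simp add: poly_form_def tensor_form_tensor bilinear_poly_pair)

lemma bilinear_poly_form: "bilinear poly_form"
  by (simp add: poly_form_def bilinear_tensor_form)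

lemma linear_poly_L: "linear (poly_L n)"
  unfolding poly_L_def by (intro linear_compose_sum ballI linear_tensor_map)

lemma poly_L_tensor: "poly_L n (d \<otimes>\<^sub>t f) = (\<Sum>k = 1..n. (pvar k * d) \<otimes>\<^sub>t pdiff k f)"
  by (simp add: poly_L_def tensor_map_tensor linear_pdiff bilinear_linear(1)[OF bilinear_poly_mult])

lemma poly_act_tensor: "poly_act \<sigma> (d \<otimes>\<^sub>t f) = poly_perm \<sigma> d \<otimes>\<^sub>t poly_perm \<sigma> f"
  by (simp add: poly_act_def tensor_map_tensor linear_poly_perm)

abbreviation finite_keys :: "ext \<Rightarrow> bool" where
  "finite_keys a \<equiv> (\<forall>S\<in>Poly_Mapping.keys a. finite S)"

lemma finite_inversions: "finite S \<Longrightarrow> finite T \<Longrightarrow> finite (inversions S T)"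
  by (rule finite_subset[of _ "S \<times> T"]) (auto simp: inversions_def)

lemma inversions_simps [simp]:
  "inversions {} T = {}" "inversions S {} = {}"
  "inversions {k} {l} = (if l < k then {(k, l)} else {})"
  by (auto simp: inversions_def)

lemma card_inversions_union_left:
  assumes "finite S" "finite T" "finite U" "S \<inter> T = {}"
  shows "card (inversions (S \<union> T) U) = card (inversions S U) + card (inversions T U)"
proof -
  have "inversions (S \<union> T) U = inversions S U \<union> inversions T U"
    by (auto simp: inversions_def)
  moreover have "inversions S U \<inter> inversions T U = {}"
    using assms by (auto simp: inversions_def)
  ultimately show ?thesis
    using assms by (simp add: card_Un_disjoint finite_inversions)
qed

lemma card_inversions_union_right:
  assumes "finite S" "finite T" "finite U" "T \<inter> U = {}"
  shows "card (inversions S (T \<union> U)) = card (inversions S T) + card (inversions S U)"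
proof -
  have "inversions S (T \<union> U) = inversions S T \<union> inversions S U"
    by (auto simp: inversions_def)
  moreover have "inversions S T \<inter> inversions S U = {}"
    using assms by (auto simp: inversions_def)
  ultimately show ?thesis
    using assms by (simp add: card_Un_disjoint finite_inversions)
qed

lemma card_inversions_singleton:
  "card (inversions {k} T) = card {t \<in> T. t < k}"
  "card (inversions S {k}) = card {s \<in> S. k < s}"
proof -
  have "inversions {k} T = Pair k ` {t \<in> T. t < k}" "inversions S {k} = (\<lambda>s. (s, k)) ` {s \<in> S. k < s}"
    by (auto simp: inversions_def)
  then show "card (inversions {k} T) = card {t \<in> T. t < k}"
    "card (inversions S {k}) = card {s \<in> S. k < s}"
    by (simp_all add: card_image inj_on_def)
qed

lemma card_inversions_remove_left:
  assumes "finite S" "finite T" "k \<in> S"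
  shows "card (inversions S T) = card (inversions (S - {k}) T) + card (inversions {k} T)"
  using card_inversions_union_left[of "S - {k}" "{k}" T] assms
  by (simp add: insert_absorb)

lemma card_inversions_remove_right:
  assumes "finite S" "finite T" "k \<in> T"
  shows "card (inversions S T) = card (inversions S (T - {k})) + card (inversions S {k})"
  using card_inversions_union_right[of S "T - {k}" "{k}"] assms
  by (simp add: insert_absorb)

lemma bilinear_wedge: "bilinear wedge"
  by (simp add: wedge_def bilinear_bilin_ext)

lemma wedge_single:
  "wedge (Poly_Mapping.single S c) (Poly_Mapping.single T d) =
    (if S \<inter> T = {} then Poly_Mapping.single (S \<union> T) (c * d * (-1) ^ card (inversions S T)) else 0)"
  by (simp add: wedge_def scaleR_single)

lemma wedge_one_left: "wedge (bvec {}) a = a"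
  by (rule linear_eq_on_keys[OF bilinear_linear(1)[OF bilinear_wedge] linear_ident])
     (simp add: wedge_single)

lemma wedge_one_right: "wedge a (bvec {}) = a"
  by (rule linear_eq_on_keys[OF bilinear_linear(2)[OF bilinear_wedge] linear_ident])
     (simp add: wedge_single)

lemma wedge_assoc_single:
  assumes "finite S" "finite T" "finite U"
  shows "wedge (wedge (bvec S) (bvec T)) (bvec U) = wedge (bvec S) (wedge (bvec T) (bvec U))"
proof (cases "S \<inter> T = {} \<and> S \<inter> U = {} \<and> T \<inter> U = {}")
  case True
  then have "card (inversions S T) + card (inversions (S \<union> T) U)
      = card (inversions T U) + card (inversions S (T \<union> U))"
    using assms by (simp add: card_inversions_union_left card_inversions_union_right)
  with True show ?thesis
    by (simp add: wedge_single Int_Un_distrib Int_Un_distrib2 Un_assoc flip: power_add)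
next
  case False
  then show ?thesis
    using bilinear_lzero[OF bilinear_wedge] bilinear_rzero[OF bilinear_wedge]
    by (auto simp: wedge_single Int_Un_distrib Int_Un_distrib2)
qed

lemma wedge_assoc:
  assumes "finite_keys a" "finite_keys b" "finite_keys c"
  shows "wedge (wedge a b) c = wedge a (wedge b c)"
proof -
  note lin = bilinear_linear[OF bilinear_wedge]
  have 1: "wedge (wedge (bvec S) (bvec T)) c = wedge (bvec S) (wedge (bvec T) c)"
    if "finite S" "finite T" for S T
    by (rule linear_eq_on_keys[OF lin(1) linear_compose[OF lin(1) lin(1), unfolded o_def]])
       (use that assms wedge_assoc_single in blast)
  have 2: "wedge (wedge (bvec S) b) c = wedge (bvec S) (wedge b c)" if "finite S" for S
    by (rule linear_eq_on_keys[OF linear_compose[OF lin(1) lin(2), unfolded o_def]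
          linear_compose[OF lin(2) lin(1), unfolded o_def]])
       (use that assms 1 in blast)
  show ?thesis
    by (rule linear_eq_on_keys[OF linear_compose[OF lin(2) lin(2), unfolded o_def] lin(2)])
       (use assms 2 in blast)
qed

lemma wedge_anticommute:
  assumes "v \<in> ext_deg n 1" "w \<in> ext_deg n 1"
  shows "wedge v w = - wedge w v"
proof (rule bilinear_eq_on_keys[of wedge "\<lambda>v w. - wedge w v"])
  show "bilinear (\<lambda>v w. - wedge w v)"
    by (rule bilinear_linear_compose[OF bilinear_swap[OF bilinear_wedge]])
       (simp add: linear_iff)
  fix S T assume "S \<in> Poly_Mapping.keys v" "T \<in> Poly_Mapping.keys w"
  then have "card S = 1" "card T = 1"
    using assms unfolding ext_deg_def by auto
  then obtain k l where "S = {k}" "T = {l}"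
    by (auto simp: card_1_singleton_iff)
  then show "wedge (bvec S) (bvec T) = - wedge (bvec T) (bvec S)"
    by (auto simp: wedge_single insert_commute single_uminus[symmetric])
qed (rule bilinear_wedge)

lemma wedge_alternating: "v \<in> ext_deg n 1 \<Longrightarrow> wedge v v = 0"
  using wedge_anticommute[of v n v] by (metis real_vector.scale_cancel_right scaleR_minus1_left
      one_neq_neg_one scaleR_one)

lemma wedge_list_egen:
  assumes "finite S"
  shows "wedge_list (map egen (sorted_list_of_set S)) = bvec S"
proof -
  have "wedge_list (map egen ks) = bvec (set ks)" if "sorted_wrt (<) ks" for ks
    using that
  proof (induction ks)
    case (Cons k ks)
    then have "inversions {k} (set ks) = {}" "k \<notin> set ks"
      by (auto simp: inversions_def)
    with Cons show ?case
      by (simp add: wedge_list_def egen_def wedge_single)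
  qed (simp add: wedge_list_def)
  then show ?thesis
    using assms by simp
qed

lemma linear_int_prod: "linear (int_prod k)"
  by (simp add: int_prod_def linear_lin_ext)

lemma int_prod_single: "int_prod k (Poly_Mapping.single S c) =
    (if k \<in> S then Poly_Mapping.single (S - {k}) (c * (-1) ^ card (inversions {k} S)) else 0)"
  by (simp add: int_prod_def scaleR_single card_inversions_singleton)

lemma int_prod_scalar: "int_prod k (bvec {}) = 0"
  by (simp add: int_prod_single)

lemma int_prod_egen: "int_prod k (egen l) = (if k = l then bvec {} else 0)"
  by (auto simp: egen_def int_prod_single)

lemma int_prod_wedge_bvec:
  assumes "finite S" "finite T"
  shows "int_prod k (wedge (bvec S) (bvec T)) =
    wedge (int_prod k (bvec S)) (bvec T) + (-1) ^ card S *\<^sub>R wedge (bvec S) (int_prod k (bvec T))"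
proof -
  let ?lt = "\<lambda>S. card (inversions {k} S)" and ?gt = "\<lambda>S. card (inversions S {k})"
  note z = bilinear_lzero[OF bilinear_wedge] bilinear_rzero[OF bilinear_wedge]
    linear_0[OF linear_int_prod]
  have S: "card S = ?lt S + ?gt S + (if k \<in> S then 1 else 0)"
  proof -
    have "S = {t \<in> S. t < k} \<union> ({t \<in> S. k < t} \<union> S \<inter> {k})"
      by auto
    then have "card S = card ({t \<in> S. t < k} \<union> ({t \<in> S. k < t} \<union> S \<inter> {k}))"
      by simp
    also have "\<dots> = card {t \<in> S. t < k} + (card {t \<in> S. k < t} + card (S \<inter> {k}))"
      using assms by (subst card_Un_disjoint; (subst card_Un_disjoint)?) auto
    finally show ?thesis
      by (auto simp: card_inversions_singleton)
  qed
  have lt: "?lt (S \<union> T) = ?lt S + ?lt T" if "S \<inter> T = {}"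
    using card_inversions_union_right[of "{k}" S T] assms that by simp
  consider (S) "S \<inter> T = {}" "k \<in> S" "k \<notin> T" | (T) "S \<inter> T = {}" "k \<notin> S" "k \<in> T"
    | (none) "k \<notin> S" "k \<notin> T" | (both) "S \<inter> T = {k}"
    | (other) l where "l \<in> S" "l \<in> T" "l \<noteq> k"
    by blast
  then show ?thesis
  proof cases
    case S
    have "S \<union> T - {k} = S - {k} \<union> T" "(S - {k}) \<inter> T = {}"
      using S by auto
    with S show ?thesis
      by (auto simp: wedge_single int_prod_single z lt minus_one_power_iff
          card_inversions_remove_left[OF assms S(2)])
  next
    case T
    have "S \<union> T - {k} = S \<union> (T - {k})" "S \<inter> (T - {k}) = {}"
      using T by auto
    with T show ?thesis
      by (simp add: wedge_single int_prod_single z lt S power_add scaleR_single ac_simps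
          card_inversions_remove_right[OF assms T(3)])
  next
    case none
    then show ?thesis
      by (simp add: wedge_single int_prod_single z)
  next
    case both
    then have k: "k \<in> S" "k \<in> T"
      by auto
    have "S - {k} \<union> T = S \<union> T" "S \<union> (T - {k}) = S \<union> T" "(S - {k}) \<inter> T = {}" "S \<inter> (T - {k}) = {}"
      using both by auto
    then have "wedge (int_prod k (bvec S)) (bvec T) + (-1) ^ card S *\<^sub>R wedge (bvec S) (int_prod k (bvec T))
        = Poly_Mapping.single (S \<union> T) ((-1) ^ ?lt S * (-1) ^ card (inversions (S - {k}) T)
          + (-1) ^ card S * ((-1) ^ ?lt T * (-1) ^ card (inversions S (T - {k}))))"
      using k by (simp add: wedge_single int_prod_single scaleR_single single_add)
    also have "(-1) ^ ?lt S * (-1) ^ card (inversions (S - {k}) T)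
          + (-1) ^ card S * ((-1) ^ ?lt T * (-1) ^ card (inversions S (T - {k}))) = (0::real)"
    proof -
      have "card (inversions (S - {k}) T) + ?lt T = card (inversions S (T - {k})) + ?gt S"
        using card_inversions_remove_left[OF assms k(1)] card_inversions_remove_right[OF assms k(2)]
        by simp
      moreover have "card S = ?lt S + ?gt S + 1"
        using S k by simp
      ultimately have "even (?lt S + card (inversions (S - {k}) T))
          \<longleftrightarrow> odd (card S + (?lt T + card (inversions S (T - {k}))))"
        by presburger
      then show ?thesis
        by (auto simp: minus_one_power_iff simp flip: power_add)
    qed
    finally show ?thesis
      using both by (simp add: wedge_single z)
  next
    case other
    then have "S \<inter> T \<noteq> {}" "(S - {k}) \<inter> T \<noteq> {}" "S \<inter> (T - {k}) \<noteq> {}"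
      by auto
    then show ?thesis
      by (simp add: wedge_single int_prod_single z)
  qed
qed

lemma int_prod_wedge:
  assumes "a \<in> ext_deg n p" "b \<in> ext_deg n q"
  shows "int_prod k (wedge a b) = wedge (int_prod k a) b + (-1) ^ p *\<^sub>R wedge a (int_prod k b)"
proof (rule bilinear_eq_on_keys[of "\<lambda>a b. int_prod k (wedge a b)"
      "\<lambda>a b. wedge (int_prod k a) b + (-1) ^ p *\<^sub>R wedge a (int_prod k b)"])
  show "bilinear (\<lambda>a b. int_prod k (wedge a b))"
    by (rule bilinear_linear_compose[OF bilinear_wedge linear_int_prod])
  show "bilinear (\<lambda>a b. wedge (int_prod k a) b + (-1) ^ p *\<^sub>R wedge a (int_prod k b))"
    using bilinear_wedge linear_int_prod[of k] unfolding bilinear_def linear_iff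
    by (simp add: algebra_simps)
next
  fix S T assume "S \<in> Poly_Mapping.keys a" "T \<in> Poly_Mapping.keys b"
  with assms have "finite S" "finite T" "card S = p"
    unfolding ext_deg_def by (auto intro: finite_subset)
  then show "int_prod k (wedge (bvec S) (bvec T)) =
      wedge (int_prod k (bvec S)) (bvec T) + (-1) ^ p *\<^sub>R wedge (bvec S) (int_prod k (bvec T))"
    using int_prod_wedge_bvec by blast
qed

lemma bilinear_ext_pair: "bilinear ext_pair"
  by (simp add: ext_pair_def bilinear_bilin_ext)

lemma ext_pair_bvec:
  assumes "finite S" "finite T"
  shows "ext_pair (bvec S) (bvec T) = (if S = T then 1 else 0)"
proof -
  let ?A = "Matrix.mat (card T) (card S) (\<lambda>(k, l).
    if sorted_list_of_set T ! k = sorted_list_of_set S ! l then 1 else (0::real))"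
  have pair: "ext_pair (bvec S) (bvec T) = (if card S = card T then Determinant.det ?A else 0)"
    by (simp add: ext_pair_def)
  consider "S = T" | "card S \<noteq> card T" | "S \<noteq> T" "card S = card T"
    by blast
  then show ?thesis
  proof cases
    case 1
    have "?A = 1\<^sub>m (card S)"
      using 1 by (intro eq_matI) (auto simp: nth_eq_iff_index_eq)
    with 1 pair show ?thesis
      by simp
  next
    case 2
    with pair show ?thesis
      by auto
  next
    case 3
    then have "\<not> S \<subseteq> T"
      using assms card_subset_eq by blast
    then obtain s where s: "s \<in> S" "s \<notin> T"
      by blast
    then obtain l where l: "l < card S" "sorted_list_of_set S ! l = s"
      using assms by (metis in_set_conv_nth length_sorted_list_of_set set_sorted_list_of_set)
    have "(\<Prod>i = 0..<card T. ?A $$ (i, p i)) = 0" if p: "p permutes {0..<card T}" for p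
    proof -
      obtain i where i: "i < card T" "p i = l"
        using permutes_image[OF p] l 3 by (metis atLeastLessThan_iff imageE zero_le)
      then have "sorted_list_of_set T ! i \<in> T"
        using assms by (metis nth_mem length_sorted_list_of_set set_sorted_list_of_set)
      then have "?A $$ (i, p i) = 0"
        using i l s by auto
      then show ?thesis
        using i by (intro prod_zero) auto
    qed
    then have "Determinant.det ?A = 0"
      using 3 by (subst det_def'[of ?A "card T"]) (auto intro!: sum.neutral simp del: index_mat)
    with pair 3 show ?thesis
      by simp
  qed
qed

lemma ext_pair_single:
  assumes "finite S" "finite T"
  shows "ext_pair (Poly_Mapping.single S c) (Poly_Mapping.single T d) = (if S = T then c * d else 0)"
proof -
  have "ext_pair (Poly_Mapping.single S c) (Poly_Mapping.single T d) = c * d * ext_pair (bvec S) (bvec T)"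
    by (simp add: ext_pair_def)
  then show ?thesis
    by (simp add: ext_pair_bvec[OF assms])
qed

lemma ext_pair_wedge_egen:
  assumes "finite_keys a" "finite_keys b"
  shows "ext_pair (wedge (egen k) a) b = ext_pair a (int_prod k b)"
proof (rule bilinear_eq_on_keys[of "\<lambda>a b. ext_pair (wedge (egen k) a) b"
      "\<lambda>a b. ext_pair a (int_prod k b)"])
  show "bilinear (\<lambda>a b. ext_pair (wedge (egen k) a) b)"
    by (rule bilinear_compose2[OF bilinear_ext_pair bilinear_linear(1)[OF bilinear_wedge] linear_ident])
  show "bilinear (\<lambda>a b. ext_pair a (int_prod k b))"
    by (rule bilinear_compose2[OF bilinear_ext_pair linear_ident linear_int_prod])
next
  fix S T assume "S \<in> Poly_Mapping.keys a" "T \<in> Poly_Mapping.keys b"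
  with assms have fin: "finite S" "finite T"
    by auto
  note z = bilinear_lzero[OF bilinear_ext_pair] bilinear_rzero[OF bilinear_ext_pair]
  show "ext_pair (wedge (egen k) (bvec S)) (bvec T) = ext_pair (bvec S) (int_prod k (bvec T))"
  proof (cases "k \<in> T \<and> S = T - {k}")
    case True
    then have "insert k S = T" "k \<notin> S" "inversions {k} S = inversions {k} T"
      by (auto simp: inversions_def)
    with True show ?thesis
      using fin
      by (simp add: egen_def wedge_single int_prod_single ext_pair_single)
  next
    case False
    then have "insert k S \<noteq> T \<or> k \<in> S" "k \<in> T \<Longrightarrow> S \<noteq> T - {k}"
      by auto
    then show ?thesis
      using fin
      by (auto simp: egen_def wedge_single int_prod_single ext_pair_single z)
  qed
qed

text \<open>Evaluation of a covector \<open>v\<close> at a vector \<open>u\<close>, where \<open>\<xi>\<^sub>j \<theta>\<^sub>k\<close> is 1 if \<open>j = k\<close> and 0 otherwise.\<close>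

definition eval_covector :: "nat \<Rightarrow> ext \<Rightarrow> ext \<Rightarrow> real" where
  "eval_covector n v u = (\<Sum>j = 1..n. Poly_Mapping.lookup v {j} * Poly_Mapping.lookup u {j})"

lemma ext_deg_1_expansion:
  assumes "u \<in> ext_deg n 1"
  shows "u = (\<Sum>j = 1..n. Poly_Mapping.lookup u {j} *\<^sub>R egen j)"
proof -
  have keys: "Poly_Mapping.keys u \<subseteq> (\<lambda>j. {j}) ` {1..n}"
  proof
    fix S assume "S \<in> Poly_Mapping.keys u"
    with assms have "S \<subseteq> {1..n}" "card S = 1"
      by (auto simp: ext_deg_def)
    then show "S \<in> (\<lambda>j. {j}) ` {1..n}"
      by (auto simp: card_1_singleton_iff)
  qed
  have "u = lin_ext bvec u"
    by (simp add: bvec_expansion)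
  also have "\<dots> = (\<Sum>S\<in>(\<lambda>j. {j}) ` {1..n}. Poly_Mapping.lookup u S *\<^sub>R bvec S)"
    by (rule lin_ext_superset[OF _ keys]) simp
  also have "\<dots> = (\<Sum>j = 1..n. Poly_Mapping.lookup u {j} *\<^sub>R egen j)"
    by (subst sum.reindex) (auto simp: egen_def inj_on_def)
  finally show ?thesis .
qed

definition int_prod_vec :: "nat \<Rightarrow> ext \<Rightarrow> ext \<Rightarrow> ext" where
  "int_prod_vec n u b = (\<Sum>j = 1..n. Poly_Mapping.lookup u {j} *\<^sub>R int_prod j b)"

lemma ext_pair_wedge_vec:
  assumes "u \<in> ext_deg n 1" "finite_keys a" "finite_keys b"
  shows "ext_pair (wedge u a) b = ext_pair a (int_prod_vec n u b)"
proof -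
  note lin = bilinear_linear[OF bilinear_ext_pair] bilinear_linear[OF bilinear_wedge]
  have "ext_pair (wedge u a) b
      = ext_pair (wedge (\<Sum>j = 1..n. Poly_Mapping.lookup u {j} *\<^sub>R egen j) a) b"
    using ext_deg_1_expansion[OF assms(1)] by simp
  also have "\<dots> = (\<Sum>j = 1..n. Poly_Mapping.lookup u {j} *\<^sub>R ext_pair (wedge (egen j) a) b)"
    by (simp add: linear_sum[OF lin(4)] linear_sum[OF lin(2)] linear_scale[OF lin(4)]
        linear_scale[OF lin(2)])
  also have "\<dots> = ext_pair a (int_prod_vec n u b)"
    using assms by (simp add: ext_pair_wedge_egen int_prod_vec_def linear_sum[OF lin(1)]
        linear_scale[OF lin(1)])
  finally show ?thesis .
qed

lemma subspace_ext_deg: "subspace (ext_deg n r)"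
proof (rule subspaceI)
  fix x y assume "x \<in> ext_deg n r" "y \<in> ext_deg n r"
  then show "x + y \<in> ext_deg n r"
    using keys_add[of x y] unfolding ext_deg_def by blast
next
  fix c x assume "x \<in> ext_deg n r"
  moreover have "Poly_Mapping.keys (c *\<^sub>R x) \<subseteq> Poly_Mapping.keys x"
    by (auto simp: in_keys_iff)
  ultimately show "c *\<^sub>R x \<in> ext_deg n r"
    unfolding ext_deg_def by blast
qed (simp add: ext_deg_def)

lemma ext_deg_wedge:
  assumes "a \<in> ext_deg n p" "b \<in> ext_deg n q"
  shows "wedge a b \<in> ext_deg n (p + q)"
proof -
  have F: "(if S \<inter> T = {} then Poly_Mapping.single (S \<union> T) ((-1) ^ card (inversions S T)) else 0)
      \<in> ext_deg n (p + q)"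
    if "S \<in> Poly_Mapping.keys a" "T \<in> Poly_Mapping.keys b" for S T
  proof -
    have "S \<subseteq> {1..n}" "T \<subseteq> {1..n}" "card S = p" "card T = q"
      using assms that by (auto simp: ext_deg_def)
    moreover from this have "finite S" "finite T"
      using finite_subset by blast+
    ultimately have "S \<union> T \<subseteq> {1..n}" "S \<inter> T = {} \<Longrightarrow> card (S \<union> T) = p + q"
      by (auto simp: card_Un_disjoint)
    then show ?thesis
      by (simp add: ext_deg_def)
  qed
  show ?thesis
    unfolding wedge_def bilin_ext_def lin_ext_def
    by (intro subspace_sum subspace_scale subspace_ext_deg F)
qed

lemma ext_deg_wedge_list:
  "set us \<subseteq> ext_deg n 1 \<Longrightarrow> wedge_list us \<in> ext_deg n (length us)"
proof (induction us)
  case (Cons u us)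
  then show ?case
    using ext_deg_wedge[of u n 1 "wedge_list us" "length us"] by (simp add: wedge_list_def)
qed (simp add: wedge_list_def ext_deg_def)

lemma ext_deg_finite_keys: "a \<in> ext_deg n p \<Longrightarrow> finite_keys a"
  unfolding ext_deg_def by (auto intro: finite_subset)

lemma int_prod_vec_wedge:
  assumes v: "v \<in> ext_deg n 1" and b: "b \<in> ext_deg n q"
  shows "int_prod_vec n u (wedge v b) = eval_covector n v u *\<^sub>R b - wedge v (int_prod_vec n u b)"
proof -
  note lin = bilinear_linear[OF bilinear_wedge]
  have j: "int_prod j v = Poly_Mapping.lookup v {j} *\<^sub>R bvec {}" if "j \<in> {1..n}" for j
  proof -
    have "int_prod j v = int_prod j (\<Sum>i = 1..n. Poly_Mapping.lookup v {i} *\<^sub>R egen i)"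
      using ext_deg_1_expansion[OF v] by simp
    also have "\<dots> = (\<Sum>i = 1..n. if i = j then Poly_Mapping.lookup v {i} *\<^sub>R bvec {} else 0)"
      unfolding linear_sum[OF linear_int_prod]
      by (rule sum.cong) (simp_all add: linear_scale[OF linear_int_prod] int_prod_egen)
    finally show ?thesis
      using that by simp
  qed
  have "int_prod_vec n u (wedge v b) = (\<Sum>j = 1..n. Poly_Mapping.lookup u {j} *\<^sub>R
      (Poly_Mapping.lookup v {j} *\<^sub>R b - wedge v (int_prod j b)))"
    unfolding int_prod_vec_def
    by (rule sum.cong) (simp_all add: int_prod_wedge[OF assms] j linear_scale[OF lin(2)] wedge_one_left)
  also have "\<dots> = eval_covector n v u *\<^sub>R b - wedge v (int_prod_vec n u b)"
    by (simp add: int_prod_vec_def eval_covector_def scaleR_diff_right sum_subtractf scaleR_sum_left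
        linear_sum[OF lin(1)] linear_scale[OF lin(1)] mult.commute)
  finally show ?thesis .
qed

lemma int_prod_vec_wedge_list:
  assumes "set vs \<subseteq> ext_deg n 1"
  shows "int_prod_vec n u (wedge_list vs) = (\<Sum>k<length vs.
    ((-1) ^ k * eval_covector n (vs ! k) u) *\<^sub>R wedge_list (take k vs @ drop (Suc k) vs))"
  using assms
proof (induction vs)
  case Nil
  then show ?case
    by (simp add: int_prod_vec_def wedge_list_def int_prod_scalar)
next
  case (Cons v vs)
  note lin = bilinear_linear[OF bilinear_wedge]
  have c: "wedge_list (v # ws) = wedge v (wedge_list ws)" for ws
    by (simp add: wedge_list_def)
  have "int_prod_vec n u (wedge_list (v # vs))
      = eval_covector n v u *\<^sub>R wedge_list vs - wedge v (int_prod_vec n u (wedge_list vs))"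
    using Cons.prems unfolding c
    by (intro int_prod_vec_wedge[of _ _ _ "length vs"] ext_deg_wedge_list) auto
  also have "wedge v (int_prod_vec n u (wedge_list vs)) = (\<Sum>k<length vs.
      ((-1) ^ k * eval_covector n (vs ! k) u) *\<^sub>R wedge_list (v # take k vs @ drop (Suc k) vs))"
    using Cons by (simp add: linear_sum[OF lin(1)] linear_scale[OF lin(1)] c)
  finally show ?case
    by (simp add: sum.lessThan_Suc_shift sum_negf del: sum.lessThan_Suc)
qed

lemma ext_pair_wedge_list:
  assumes "set us \<subseteq> ext_deg n 1" "set vs \<subseteq> ext_deg n 1"
  shows "ext_pair (wedge_list us) (wedge_list vs) =
    (if length us = length vs
     then Determinant.det (Matrix.mat (length vs) (length us) (\<lambda>(k, l). eval_covector n (vs ! k) (us ! l)))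
     else 0)"
  using assms
proof (induction us arbitrary: vs)
  case Nil
  show ?case
  proof (cases "vs = []")
    case True
    then show ?thesis
      by (simp add: wedge_list_def ext_pair_bvec det_dim_zero)
  next
    case False
    have "ext_pair (bvec {}) (wedge_list vs) = (\<lambda>_. 0) (wedge_list vs)"
    proof (rule linear_eq_on_keys[OF bilinear_linear(1)[OF bilinear_ext_pair]])
      fix S assume "S \<in> Poly_Mapping.keys (wedge_list vs)"
      then have "finite S" "card S = length vs"
        using ext_deg_wedge_list[OF Nil(2)] by (auto simp: ext_deg_def intro: finite_subset)
      then show "ext_pair (bvec {}) (bvec S) = 0"
        using False by (auto simp: ext_pair_bvec)
    qed (simp add: linear_iff)
    with False show ?thesis
      by (simp add: wedge_list_def)
  qed
next
  case (Cons u us)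
  let ?del = "\<lambda>k. take k vs @ drop (Suc k) vs"
  let ?A = "Matrix.mat (length vs) (Suc (length us)) (\<lambda>(k, l). eval_covector n (vs ! k) ((u # us) ! l))"
  note lin = bilinear_linear[OF bilinear_ext_pair]
  have us: "set us \<subseteq> ext_deg n 1" and u: "u \<in> ext_deg n 1"
    using Cons.prems by auto
  have del: "set (?del k) \<subseteq> ext_deg n 1" for k
    using Cons.prems(2) by (auto dest: in_set_takeD in_set_dropD)
  have len: "length (?del k) = length vs - 1" if "k < length vs" for k
    using that by simp
  have "ext_pair (wedge_list (u # us)) (wedge_list vs)
      = ext_pair (wedge_list us) (int_prod_vec n u (wedge_list vs))"
    using ext_pair_wedge_vec[OF u] ext_deg_finite_keys ext_deg_wedge_list us Cons.prems(2)
    by (metis wedge_list_def foldr.simps(2) comp_apply)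
  also have "\<dots> = (\<Sum>k<length vs. ((-1) ^ k * eval_covector n (vs ! k) u)
      * ext_pair (wedge_list us) (wedge_list (?del k)))"
    by (simp add: int_prod_vec_wedge_list[OF Cons.prems(2)] linear_sum[OF lin(1)] linear_scale[OF lin(1)])
  also have "\<dots> = (if length (u # us) = length vs then Determinant.det ?A else 0)"
  proof (cases "length vs = Suc (length us)")
    case False
    then show ?thesis
      using Cons.IH[OF us del] len by (intro trans[OF sum.neutral]) auto
  next
    case True
    have A: "?A \<in> carrier_mat (Suc (length us)) (Suc (length us))"
      using True by simp
    have "Determinant.det ?A = (\<Sum>k<Suc (length us). ?A $$ (k, 0) * cofactor ?A k 0)"
      by (rule laplace_expansion_column[OF A]) simp
    also have "\<dots> = (\<Sum>k<length vs. ((-1) ^ k * eval_covector n (vs ! k) u)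
      * ext_pair (wedge_list us) (wedge_list (?del k)))"
    proof (rule sum.cong)
      show "{..<Suc (length us)} = {..<length vs}"
        using True by simp
    next
      fix k assume "k \<in> {..<length vs}"
      then have k: "k < length vs"
        by simp
      have "mat_delete ?A k 0
          = Matrix.mat (length (?del k)) (length us) (\<lambda>(i, l). eval_covector n (?del k ! i) (us ! l))"
        using True k
        by (intro eq_matI) (auto simp: mat_delete_def nth_append min_def)
      then have "ext_pair (wedge_list us) (wedge_list (?del k)) = Determinant.det (mat_delete ?A k 0)"
        using Cons.IH[OF us del] len[OF k] True by simp
      then show "?A $$ (k, 0) * cofactor ?A k 0 = ((-1) ^ k * eval_covector n (vs ! k) u)
          * ext_pair (wedge_list us) (wedge_list (?del k))"
        using k by (simp add: cofactor_def)
    qed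
    finally show ?thesis
      using True by simp
  qed
  finally show ?case
    by simp
qed

lemma linear_ext_perm: "linear (ext_perm \<sigma>)"
  by (simp add: ext_perm_def linear_lin_ext)

lemma bilinear_ext_form: "bilinear (ext_form n m)"
  using bilinear_tensor_form[of ext_pair]
  unfolding bilinear_def linear_iff ext_form_def by (simp add: algebra_simps)

lemma ext_form_tensor:
  "ext_form n m (u \<otimes>\<^sub>t v) (u' \<otimes>\<^sub>t v') =
    (-1) ^ (if m \<le> n then m * (m - 1) div 2 else (2 * n - m) * (2 * n - m - 1) div 2)
    * (ext_pair u v' * ext_pair u' v)"
  by (simp add: ext_form_def tensor_form_tensor bilinear_ext_pair)

lemma linear_ext_L: "linear (ext_L n)"
  unfolding ext_L_def by (intro linear_compose_sum ballI linear_tensor_map)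

lemma ext_L_tensor: "ext_L n (u \<otimes>\<^sub>t v) = (\<Sum>k = 1..n. wedge (egen k) u \<otimes>\<^sub>t int_prod k v)"
  by (simp add: ext_L_def tensor_map_tensor linear_int_prod bilinear_linear(1)[OF bilinear_wedge])

lemma ext_act_tensor: "ext_act \<sigma> (u \<otimes>\<^sub>t v) = ext_perm \<sigma> u \<otimes>\<^sub>t ext_perm \<sigma> v"
  by (simp add: ext_act_def tensor_map_tensor linear_ext_perm)

end

theory Submission
  imports Defs
begin

text \<open>
  Both triples are instances of one construction. On the polynomial ring and on the exterior
  algebra there are creation operators \<open>up k\<close> (multiplication by the \<open>k\<close>-th generator) and
  annihilation operators \<open>dn k\<close> (partial derivative, interior product) with
  \<open>dn k (up l x) = e * up l (dn k x) + \<delta>\<^sub>k\<^sub>l x\<close>, where \<open>e = 1\<close> for polynomials and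
  \<open>e = -1\<close> for exterior powers. The locale \<open>oscillator\<close> collects these relations, Euler's identity
  \<open>\<Sum> up k (dn k x) = i * x\<close> in degree \<open>i\<close>, the adjointness of \<open>up k\<close> and \<open>dn k\<close>, and the
  compatibility of \<open>up\<close> with permutations; the theorem is derived from them for both signs at once.

  On the tensor square, \<open>L = \<Sum> up k \<otimes> dn k\<close> and its conjugate \<open>M = \<Sum> dn k \<otimes> up k\<close> under the
  exchange of the two factors satisfy \<open>[L, M] = i - j\<close> on the piece of bidegree \<open>(i, j)\<close>: the
  terms with the factor \<open>e\<close> are the same in both products. So there is a representation of \<open>sl\<^sub>2\<close> in which the
  degree is the weight, and hard Lefschetz follows (\<open>hard_lefschetz_bij\<close>).

  The pairing is \<open>\<langle>x, y\<rangle> = \<plusminus>(x, swap y)\<close> for the inner product \<open>(-, -)\<close> that makes \<open>up k\<close> and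
  \<open>dn k\<close> adjoint to each other on both factors. It is positive definite
  (\<open>inner_product_on_W\<close>), which gives Poincare duality. For the Hodge--Riemann relations it
  remains to evaluate \<open>swap (L\<^sup>r x)\<close> for a primitive \<open>x\<close> of bidegree \<open>(i, i + r)\<close>. This is the
  heart of the proof (\<open>swap_L_pow_primitive\<close>): with \<open>m = 2 i + r\<close>,
  \<open>swap (L\<^sup>r x) = (-1)\<^sup>i * e\<^bsup>m choose 2\<^esup> * r! * x\<close>. Hence the Lefschetz form is a multiple of the
  inner product on primitive vectors, of sign \<open>(-1)\<^sup>i\<close> up to a factor depending on \<open>m\<close> only. That
  factor is \<open>1\<close> for polynomials; for exterior powers it is combined with the sign
  \<open>(-1)\<^sup>\<epsilon>\<close> of the pairing, which leaves \<open>(-1)\<^sup>s\<close> with \<open>s = max 0 (m - n)\<close>.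

  Equivariance rests on the fact that permutations carry \<open>up k\<close> to \<open>up (\<sigma> k)\<close>; the rest follows by
  induction on the degree, since by Euler's identity every vector of positive degree is a
  combination of vectors \<open>up k y\<close>.
\<close>

section \<open>Hard Lefschetz for bigraded representations of sl2\<close>

text \<open>
  \<open>L\<close> and \<open>M\<close> are the raising and the lowering operator; \<open>W i j\<close> has weight \<open>i - j\<close>. The bidegree
  is recorded instead of the weight because \<open>M\<close> vanishes on \<open>W 0 j\<close> and \<open>L\<close> on \<open>W i 0\<close>. This makes
  both operators locally nilpotent, and inductions on \<open>i\<close> take the place of dimension counts.
\<close>

locale bigraded_sl2 =
  fixes W :: "nat \<Rightarrow> nat \<Rightarrow> 'a::real_vector set" and L M :: "'a \<Rightarrow> 'a"
  assumes subspace_W: "subspace (W i j)"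
    and linear_L: "linear L" and linear_M: "linear M"
    and L_mem: "x \<in> W i (Suc j) \<Longrightarrow> L x \<in> W (Suc i) j"
    and L_top: "x \<in> W i 0 \<Longrightarrow> L x = 0"
    and M_mem: "x \<in> W (Suc i) j \<Longrightarrow> M x \<in> W i (Suc j)"
    and M_bottom: "x \<in> W 0 j \<Longrightarrow> M x = 0"
    and commutator: "x \<in> W i j \<Longrightarrow> L (M x) = M (L x) + (real i - real j) *\<^sub>R x"
begin

lemmas L_simps = linear_0[OF linear_L] linear_add[OF linear_L] linear_diff[OF linear_L]
  linear_scale[OF linear_L]
lemmas M_simps = linear_0[OF linear_M] linear_add[OF linear_M] linear_diff[OF linear_M]
  linear_scale[OF linear_M]
lemmas L_pow_simps = linear_0[OF linear_funpow[OF linear_L]] linear_add[OF linear_funpow[OF linear_L]]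
  linear_diff[OF linear_funpow[OF linear_L]] linear_scale[OF linear_funpow[OF linear_L]]
lemmas M_pow_simps = linear_0[OF linear_funpow[OF linear_M]] linear_add[OF linear_funpow[OF linear_M]]
  linear_diff[OF linear_funpow[OF linear_M]] linear_scale[OF linear_funpow[OF linear_M]]

text \<open>
  The symmetry that turns each statement about lowest weight vectors into one about highest weight
  vectors.
\<close>

lemma swapped: "bigraded_sl2 (\<lambda>i j. W j i) M L"
  by (rule bigraded_sl2.intro)
    (simp_all add: subspace_W linear_L linear_M L_mem L_top M_mem M_bottom commutator
      algebra_simps flip: scaleR_add_left)

lemma L_pow_mem: "x \<in> W i (j + s) \<Longrightarrow> (L ^^ s) x \<in> W (i + s) j"
  by (induction s arbitrary: j) (simp, metis L_mem add_Suc_right add_Suc funpow.simps(2) comp_apply)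

lemma L_pow_mem': "x \<in> W i j \<Longrightarrow> s \<le> j \<Longrightarrow> (L ^^ s) x \<in> W (i + s) (j - s)"
  using L_pow_mem[of x i "j - s" s] by simp

lemma L_pow_eq_0: "x \<in> W i j \<Longrightarrow> j < s \<Longrightarrow> (L ^^ s) x = 0"
proof -
  assume x: "x \<in> W i j" and s: "j < s"
  have "(L ^^ Suc j) x = 0"
    using L_top L_pow_mem[of x i 0 j] x by simp
  moreover have "L ^^ s = (L ^^ (s - Suc j)) \<circ> (L ^^ Suc j)"
    using s by (simp only: flip: funpow_add) simp
  ultimately show ?thesis
    by (simp add: L_pow_simps del: funpow.simps)
qed

text \<open>
  The commutator relation at \<open>L\<^sup>s x\<close>, which holds also when \<open>s > j\<close>: then \<open>L\<^sup>s x\<close> vanishes. In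
  this form the relation can be iterated over all \<open>s\<close>.
\<close>

lemma M_L_L_pow:
  assumes "x \<in> W i j"
  shows "M (L ((L ^^ s) x)) = L (M ((L ^^ s) x)) + (real j - real i - 2 * real s) *\<^sub>R (L ^^ s) x"
proof (cases "s \<le> j")
  case True
  then show ?thesis
    using commutator[OF L_pow_mem'[OF assms True]] by (simp flip: scaleR_add_left)
next
  case False
  then show ?thesis
    using L_pow_eq_0[OF assms] by (simp add: L_simps M_simps)
qed

lemma M_L_pow:
  assumes "x \<in> W i j"
  shows "M ((L ^^ Suc s) x)
    = (L ^^ Suc s) (M x) + (real (Suc s) * (real j - real i - real s)) *\<^sub>R (L ^^ s) x"
proof (induction s)
  case 0
  then show ?case
    using M_L_L_pow[OF assms, of 0] by simp
next
  case (Suc s)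
  have "M ((L ^^ Suc (Suc s)) x)
      = L (M ((L ^^ Suc s) x)) + (real j - real i - 2 * real (Suc s)) *\<^sub>R (L ^^ Suc s) x"
    using M_L_L_pow[OF assms, of "Suc s"] by simp
  also have "\<dots> = (L ^^ Suc (Suc s)) (M x)
      + (real (Suc s) * (real j - real i - real s) + (real j - real i - 2 * real (Suc s)))
        *\<^sub>R (L ^^ Suc s) x"
    unfolding Suc by (simp only: L_simps scaleR_add_left funpow.simps comp_apply add.assoc)
  also have "real (Suc s) * (real j - real i - real s) + (real j - real i - 2 * real (Suc s))
      = real (Suc (Suc s)) * (real j - real i - real (Suc s))"
    by (simp add: algebra_simps)
  finally show ?case .
qed

lemma M_pow_L_pow_primitive:
  assumes x: "x \<in> W i (i + r)" and M: "M x = 0" and s: "s \<le> r"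
  shows "\<exists>c>0. (M ^^ s) ((L ^^ s) x) = c *\<^sub>R x"
  using s
proof (induction s)
  case 0
  show ?case
    by (rule exI[of _ 1]) simp
next
  case (Suc s)
  then obtain c where c: "c > 0" "(M ^^ s) ((L ^^ s) x) = c *\<^sub>R x"
    by auto
  have "M ((L ^^ Suc s) x) = (real (Suc s) * (real r - real s)) *\<^sub>R (L ^^ s) x"
    using M_L_pow[OF x, of s] by (simp add: M L_pow_simps L_simps)
  then have "(M ^^ Suc s) ((L ^^ Suc s) x) = (real (Suc s) * (real r - real s) * c) *\<^sub>R x"
    by (simp add: funpow_Suc_right M_pow_simps c del: funpow.simps)
  moreover have "real (Suc s) * (real r - real s) * c > 0"
    using c Suc.prems by simp
  ultimately show ?case
    by blast
qed

text \<open>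
  In weight \<open>-r\<close> the scalar of \<open>M_L_pow\<close> vanishes at \<open>s = r\<close>. Therefore \<open>L\<^bsup>r+1\<^esup> x = 0\<close> implies
  \<open>L\<^bsup>r+1\<^esup> (M x) = 0\<close>, a statement about a vector of smaller first degree.
\<close>

lemma L_pow_M:
  assumes "x \<in> W i (i + r)"
  shows "(L ^^ Suc r) (M x) = M ((L ^^ Suc r) x)"
  using M_L_pow[OF assms, of r] by simp

text \<open>
  If \<open>L\<^sup>r x = 0\<close>, then \<open>L\<^bsup>r+2\<^esup>\<close> kills \<open>M x\<close>, which has weight \<open>-(r+2)\<close>; by induction \<open>M x = 0\<close>. So
  \<open>x\<close> is a lowest weight vector, and \<open>M\<^sup>r L\<^sup>r x\<close> is a positive multiple of it.
\<close>

lemma L_pow_injective: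
  "x \<in> W i (i + r) \<Longrightarrow> (L ^^ r) x = 0 \<Longrightarrow> x = 0"
proof (induction i arbitrary: x r)
  case 0
  then obtain c where "c > 0" "(M ^^ r) ((L ^^ r) x) = c *\<^sub>R x"
    using M_pow_L_pow_primitive[of x 0 r r] M_bottom by auto
  then show ?case
    using 0 by (simp add: M_pow_simps)
next
  case (Suc i)
  have "(L ^^ Suc r) (M x) = 0"
    using L_pow_M[OF Suc.prems(1)] Suc.prems(2) by (simp add: L_simps M_simps)
  then have "(L ^^ Suc (Suc r)) (M x) = 0"
    by (simp add: L_simps)
  moreover have "M x \<in> W i (i + Suc (Suc r))"
    using M_mem[of x i "Suc i + r"] Suc.prems by simp
  ultimately have "M x = 0"
    using Suc.IH by blast
  then obtain c where "c > 0" "(M ^^ r) ((L ^^ r) x) = c *\<^sub>R x"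
    using M_pow_L_pow_primitive[of x "Suc i" r r] Suc.prems by auto
  then show ?case
    using Suc.prems by (simp add: M_pow_simps)
qed

text \<open>
  Primitive vectors are of lowest weight: this is the argument for \<open>L_pow_injective\<close>, started one
  power higher.
\<close>

lemma primitive_imp_M_eq_0:
  assumes x: "x \<in> W i (i + r)" and L: "(L ^^ Suc r) x = 0"
  shows "M x = 0"
proof (cases i)
  case 0
  then show ?thesis
    using x M_bottom by simp
next
  case (Suc k)
  have "(L ^^ Suc (Suc r)) (M x) = 0"
    using L_pow_M[OF x] L by (simp add: L_simps M_simps)
  moreover have "M x \<in> W k (k + Suc (Suc r))"
    using M_mem[of x k "i + r"] x Suc by simp
  ultimately show ?thesis
    by (rule L_pow_injective[rotated])
qed

lemma highest_weight_in_range: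
  assumes y: "y \<in> W (i + r) i" and L: "L y = 0"
  shows "\<exists>x\<in>W i (i + r). (L ^^ r) x = y"
proof -
  interpret swap: bigraded_sl2 "\<lambda>i j. W j i" M L
    by (rule swapped)
  obtain c where c: "c > 0" "(L ^^ r) ((M ^^ r) y) = c *\<^sub>R y"
    using swap.M_pow_L_pow_primitive[OF y L order_refl] by blast
  have "(L ^^ r) ((1 / c) *\<^sub>R (M ^^ r) y) = y"
    using c by (simp add: L_pow_simps)
  moreover have "(1 / c) *\<^sub>R (M ^^ r) y \<in> W i (i + r)"
    using swap.L_pow_mem[OF y] subspace_W by (simp add: subspace_scale)
  ultimately show ?thesis
    by blast
qed

text \<open>
  By induction \<open>L y = L\<^bsup>r+2\<^esup> u\<close> for some \<open>u\<close>, so that \<open>y\<close> differs from \<open>L\<^sup>r (L u)\<close> by a highest weight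
  vector, which lies in the range of \<open>L\<^sup>r\<close>.
\<close>

lemma L_pow_surjective:
  "y \<in> W (i + r) i \<Longrightarrow> \<exists>x\<in>W i (i + r). (L ^^ r) x = y"
proof (induction i arbitrary: y r)
  case 0
  then show ?case
    using highest_weight_in_range[of y 0 r] L_top by simp
next
  case (Suc i)
  have "L y \<in> W (i + Suc (Suc r)) i"
    using L_mem[of y "Suc i + r" i] Suc.prems by simp
  then obtain u where u: "u \<in> W i (i + Suc (Suc r))" "(L ^^ Suc (Suc r)) u = L y"
    using Suc.IH by blast
  have Lu: "L u \<in> W (Suc i) (Suc i + r)"
    using L_mem[of u i "Suc i + r"] u by simp
  have "(L ^^ r) (L u) \<in> W (Suc i + r) (Suc i)"
    using L_pow_mem[OF Lu] by simp
  then have "y - (L ^^ r) (L u) \<in> W (Suc i + r) (Suc i)"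
    using Suc.prems subspace_W by (simp add: subspace_diff)
  moreover have "L (y - (L ^^ r) (L u)) = 0"
    using u by (simp add: L_simps funpow_swap1)
  ultimately obtain v where "v \<in> W (Suc i) (Suc i + r)" "(L ^^ r) v = y - (L ^^ r) (L u)"
    using highest_weight_in_range by blast
  then show ?case
    using Lu subspace_W by (intro bexI[of _ "v + L u"]) (simp_all add: L_pow_simps subspace_add)
qed

lemma hard_lefschetz_bij: "bij_betw (L ^^ r) (W i (i + r)) (W (i + r) i)"
proof (rule bij_betw_imageI)
  show "inj_on (L ^^ r) (W i (i + r))"
    using L_pow_injective[of _ i r] subspace_W
    by (intro inj_onI) (metis (no_types, lifting) L_pow_simps(3) eq_iff_diff_eq_0 subspace_diff)
  show "(L ^^ r) ` W i (i + r) = W (i + r) i"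
    using L_pow_surjective L_pow_mem by (force simp: image_iff)
qed

text \<open>
  A lowest weight vector of weight \<open>-(r-1)\<close> is killed by \<open>L\<^sup>r\<close>: the power \<open>L\<^sup>r x\<close> is again killed by
  \<open>M\<close>, but its weight \<open>r + 1\<close> is positive, where \<open>M\<close> is injective. For \<open>r = 0\<close> this says that there
  are no lowest weight vectors of weight \<open>1\<close>.
\<close>

lemma L_pow_eq_0_of_M_eq_0:
  assumes x: "x \<in> W (Suc i) (i + r)" and M: "M x = 0"
  shows "(L ^^ r) x = 0"
proof -
  interpret swap: bigraded_sl2 "\<lambda>i j. W j i" M L
    by (rule swapped)
  have "M ((L ^^ r) x) = 0"
  proof (cases r)
    case (Suc s)
    then show ?thesis
      using M_L_pow[OF x, of s] M by (simp add: L_simps L_pow_simps)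
  qed (use M in simp)
  then have "(M ^^ Suc r) ((L ^^ r) x) = 0"
    by (simp add: funpow_Suc_right M_pow_simps del: funpow.simps)
  moreover have "(L ^^ r) x \<in> W (i + Suc r) i"
    using L_pow_mem[OF x] by simp
  ultimately show ?thesis
    by (rule swap.L_pow_injective[rotated])
qed

end

section \<open>Subspaces spanned by basis vectors\<close>

definition supported_on :: "'k set \<Rightarrow> ('k \<Rightarrow>\<^sub>0 real) set" where
  "supported_on K = {x. Poly_Mapping.keys x \<subseteq> K}"

lemma subspace_supported_on: "subspace (supported_on K)"
proof (rule subspaceI)
  fix x y assume "x \<in> supported_on K" "y \<in> supported_on K"
  then show "x + y \<in> supported_on K"
    using keys_add[of x y] unfolding supported_on_def by blast
next
  fix c x assume "x \<in> supported_on K"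
  moreover have "Poly_Mapping.keys (c *\<^sub>R x) \<subseteq> Poly_Mapping.keys x"
    by (auto simp: in_keys_iff)
  ultimately show "c *\<^sub>R x \<in> supported_on K"
    unfolding supported_on_def by blast
qed (simp add: supported_on_def)

lemma bvec_supported_on [simp]: "bvec k \<in> supported_on K \<longleftrightarrow> k \<in> K"
  by (simp add: supported_on_def)

lemma linear_maps_supported_on:
  assumes "linear f" "subspace S" "\<And>k. k \<in> K \<Longrightarrow> f (bvec k) \<in> S" "x \<in> supported_on K"
  shows "f x \<in> S"
proof -
  have "f x = lin_ext (\<lambda>k. f (bvec k)) x"
    using assms(1) by (rule linear_eq_lin_ext)
  also have "\<dots> \<in> S"
    unfolding lin_ext_def using assms
    by (intro subspace_sum subspace_scale) (auto simp: supported_on_def)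
  finally show ?thesis .
qed

lemma linear_eq_supported_on:
  assumes "linear f" "linear g" "\<And>k. k \<in> K \<Longrightarrow> f (bvec k) = g (bvec k)" "x \<in> supported_on K"
  shows "f x = g x"
  using assms(1,2) by (rule linear_eq_on_keys) (use assms(3,4) in \<open>auto simp: supported_on_def\<close>)

lemma tensor_supported_on:
  assumes "u \<in> supported_on K" "v \<in> supported_on K'"
  shows "u \<otimes>\<^sub>t v \<in> supported_on (K \<times> K')"
proof -
  have "(k, l) \<in> K \<times> K'" if "(k, l) \<in> Poly_Mapping.keys (u \<otimes>\<^sub>t v)" for k l
  proof -
    have "Poly_Mapping.lookup u k * Poly_Mapping.lookup v l \<noteq> 0"
      using that by (simp only: in_keys_iff lookup_tensor) simp
    then show ?thesis
      using assms by (auto simp: supported_on_def in_keys_iff)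
  qed
  then show ?thesis
    unfolding supported_on_def by (simp add: subrelI)
qed

lemma linear_maps_tensor:
  assumes "linear f" "subspace S"
    and "\<And>u v. u \<in> supported_on K \<Longrightarrow> v \<in> supported_on K' \<Longrightarrow> f (u \<otimes>\<^sub>t v) \<in> S"
    and "x \<in> supported_on (K \<times> K')"
  shows "f x \<in> S"
  using assms(1,2)
proof (rule linear_maps_supported_on[OF _ _ _ assms(4)])
  fix p assume "p \<in> K \<times> K'"
  then show "f (bvec p) \<in> S"
    using assms(3)[of "bvec (fst p)" "bvec (snd p)"] by auto
qed

lemma linear_eq_tensor:
  assumes "linear f" "linear g"
    and "\<And>u v. u \<in> supported_on K \<Longrightarrow> v \<in> supported_on K' \<Longrightarrow> f (u \<otimes>\<^sub>t v) = g (u \<otimes>\<^sub>t v)"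
    and "x \<in> supported_on (K \<times> K')"
  shows "f x = g x"
  using assms(1,2)
proof (rule linear_eq_supported_on[OF _ _ _ assms(4)])
  fix p assume "p \<in> K \<times> K'"
  then show "f (bvec p) = g (bvec p)"
    using assms(3)[of "bvec (fst p)" "bvec (snd p)"] by auto
qed

lemma bilinear_eq_tensor:
  assumes "bilinear f" "bilinear g"
    and "\<And>u v u' v'. u \<in> supported_on K \<Longrightarrow> v \<in> supported_on K' \<Longrightarrow>
      u' \<in> supported_on J \<Longrightarrow> v' \<in> supported_on J' \<Longrightarrow>
      f (u \<otimes>\<^sub>t v) (u' \<otimes>\<^sub>t v') = g (u \<otimes>\<^sub>t v) (u' \<otimes>\<^sub>t v')"
    and "x \<in> supported_on (K \<times> K')" "y \<in> supported_on (J \<times> J')"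
  shows "f x y = g x y"
  using assms(1,2)
proof (rule bilinear_eq_on_keys)
  fix p q assume "p \<in> Poly_Mapping.keys x" "q \<in> Poly_Mapping.keys y"
  then have "p \<in> K \<times> K'" "q \<in> J \<times> J'"
    using assms(4,5) by (auto simp: supported_on_def)
  then show "f (bvec p) (bvec q) = g (bvec p) (bvec q)"
    using assms(3)[of "bvec (fst p)" "bvec (snd p)" "bvec (fst q)" "bvec (snd q)"] by auto
qed

lemma span_tensors:
  "span {u \<otimes>\<^sub>t v | u v. u \<in> supported_on K \<and> v \<in> supported_on K'} = supported_on (K \<times> K')"
proof
  show "span {u \<otimes>\<^sub>t v | u v. u \<in> supported_on K \<and> v \<in> supported_on K'} \<subseteq> supported_on (K \<times> K')"
    by (rule span_minimal) (auto simp: tensor_supported_on subspace_supported_on)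
  show "supported_on (K \<times> K') \<subseteq> span {u \<otimes>\<^sub>t v | u v. u \<in> supported_on K \<and> v \<in> supported_on K'}"
  proof
    fix x assume x: "x \<in> supported_on (K \<times> K')"
    show "x \<in> span {u \<otimes>\<^sub>t v | u v. u \<in> supported_on K \<and> v \<in> supported_on K'}"
      by (rule linear_maps_tensor[OF linear_ident subspace_span _ x]) (auto intro: span_base)
  qed
qed

lemmas tensor_simps =
  bilinear_ladd[OF bilinear_tensor] bilinear_radd[OF bilinear_tensor]
  bilinear_lmul[OF bilinear_tensor] bilinear_rmul[OF bilinear_tensor]
  bilinear_lzero[OF bilinear_tensor] bilinear_rzero[OF bilinear_tensor]

lemma tensor_sum_left: "sum f S \<otimes>\<^sub>t v = (\<Sum>k\<in>S. f k \<otimes>\<^sub>t v)"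
  by (rule linear_sum[OF bilinear_linear(2)[OF bilinear_tensor]])

lemma tensor_sum_right: "v \<otimes>\<^sub>t sum f S = (\<Sum>k\<in>S. v \<otimes>\<^sub>t f k)"
  by (rule linear_sum[OF bilinear_linear(1)[OF bilinear_tensor]])

definition tensor_swap :: "('a \<times> 'b \<Rightarrow>\<^sub>0 real) \<Rightarrow> ('b \<times> 'a \<Rightarrow>\<^sub>0 real)" where
  "tensor_swap = lin_ext (\<lambda>(k, l). bvec (l, k))"

lemma linear_tensor_swap: "linear tensor_swap"
  by (simp add: tensor_swap_def linear_lin_ext)

lemma tensor_swap_tensor [simp]: "tensor_swap (u \<otimes>\<^sub>t v) = v \<otimes>\<^sub>t u"
  unfolding tensor_swap_def
  by (rule bilinear_eq_on_keys[OF bilinear_linear_compose[OF bilinear_tensor linear_lin_ext]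
        bilinear_swap[OF bilinear_tensor]]) simp

lemma tensor_swap_swap [simp]: "tensor_swap (tensor_swap x) = x"
proof (rule linear_eq_on_keys[OF linear_compose[OF linear_tensor_swap linear_tensor_swap, unfolded o_def] linear_ident])
  fix p :: "'a \<times> 'b" assume "p \<in> Poly_Mapping.keys x"
  show "tensor_swap (tensor_swap (bvec p)) = bvec p"
    by (cases p) (simp add: tensor_swap_def)
qed

lemma tensor_swap_mem:
  "x \<in> supported_on (K \<times> K') \<Longrightarrow> tensor_swap x \<in> supported_on (K' \<times> K)"
  by (rule linear_maps_tensor[OF linear_tensor_swap subspace_supported_on])
     (simp_all add: tensor_supported_on)

section \<open>Oscillators\<close>

text \<open>
  A Fock space, bosonic for \<open>e = 1\<close> and fermionic for \<open>e = -1\<close>. The basis vectors of degree \<open>i\<close> are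
  indexed by \<open>K i\<close>, and \<open>z\<close> indexes the vacuum. The hypotheses are kept to what is immediate in
  both algebras: the relations between two operators \<open>dn\<close>, the behaviour of \<open>dn\<close> under
  permutations, and the symmetry, positivity and invariance of \<open>pair\<close> are consequences.
\<close>

locale oscillator =
  fixes n :: nat and e :: real
    and K :: "nat \<Rightarrow> 'k set" and z :: 'k
    and up dn :: "nat \<Rightarrow> ('k \<Rightarrow>\<^sub>0 real) \<Rightarrow> ('k \<Rightarrow>\<^sub>0 real)"
    and pair :: "('k \<Rightarrow>\<^sub>0 real) \<Rightarrow> ('k \<Rightarrow>\<^sub>0 real) \<Rightarrow> real"
    and perm :: "(nat \<Rightarrow> nat) \<Rightarrow> ('k \<Rightarrow>\<^sub>0 real) \<Rightarrow> ('k \<Rightarrow>\<^sub>0 real)"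
  assumes e_square: "e * e = 1"
    and K_0: "K 0 = {z}"
    and linear_up: "linear (up k)" and linear_dn: "linear (dn k)"
    and up_mem: "k \<in> {1..n} \<Longrightarrow> x \<in> supported_on (K i) \<Longrightarrow> up k x \<in> supported_on (K (Suc i))"
    and dn_mem: "x \<in> supported_on (K (Suc i)) \<Longrightarrow> dn k x \<in> supported_on (K i)"
    and dn_bottom: "x \<in> supported_on (K 0) \<Longrightarrow> dn k x = 0"
    and dn_up: "k \<in> {1..n} \<Longrightarrow> l \<in> {1..n} \<Longrightarrow> x \<in> supported_on (K i) \<Longrightarrow>
      dn k (up l x) = e *\<^sub>R up l (dn k x) + (if k = l then x else 0)"
    and euler: "x \<in> supported_on (K i) \<Longrightarrow> (\<Sum>k = 1..n. up k (dn k x)) = real i *\<^sub>R x"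
    and bilinear_pair: "bilinear pair"
    and pair_up: "k \<in> {1..n} \<Longrightarrow> x \<in> supported_on (K i) \<Longrightarrow> y \<in> supported_on (K (Suc i)) \<Longrightarrow>
      pair (up k x) y = pair x (dn k y)"
    and pair_vacuum: "pair (bvec z) (bvec z) = 1"
    and linear_perm: "linear (perm \<sigma>)"
    and perm_up: "\<sigma> permutes {1..n} \<Longrightarrow> k \<in> {1..n} \<Longrightarrow> x \<in> supported_on (K i) \<Longrightarrow>
      perm \<sigma> (up k x) = up (\<sigma> k) (perm \<sigma> x)"
    and perm_vacuum: "\<sigma> permutes {1..n} \<Longrightarrow> perm \<sigma> (bvec z) = bvec z"
begin

abbreviation A :: "nat \<Rightarrow> ('k \<Rightarrow>\<^sub>0 real) set" where
  "A i \<equiv> supported_on (K i)"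

abbreviation W :: "nat \<Rightarrow> nat \<Rightarrow> ('k \<times> 'k \<Rightarrow>\<^sub>0 real) set" where
  "W i j \<equiv> supported_on (K i \<times> K j)"

lemmas up_simps = linear_0[OF linear_up] linear_add[OF linear_up] linear_scale[OF linear_up]
  linear_diff[OF linear_up] linear_sum[OF linear_up]
lemmas dn_simps = linear_0[OF linear_dn] linear_add[OF linear_dn] linear_scale[OF linear_dn]
  linear_diff[OF linear_dn] linear_sum[OF linear_dn]
lemmas perm_simps = linear_0[OF linear_perm] linear_add[OF linear_perm] linear_scale[OF linear_perm]
  linear_diff[OF linear_perm] linear_sum[OF linear_perm]
lemmas pair_linear = bilinear_linear[OF bilinear_pair]

lemma A_0_eq:
  assumes "x \<in> A 0"
  obtains c where "x = c *\<^sub>R bvec z"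
proof
  have "x = lin_ext bvec x"
    by (simp add: bvec_expansion)
  also have "\<dots> = (\<Sum>k\<in>{z}. Poly_Mapping.lookup x k *\<^sub>R bvec k)"
    using assms by (intro lin_ext_superset) (auto simp: K_0 supported_on_def)
  finally show "x = Poly_Mapping.lookup x z *\<^sub>R bvec z"
    by simp
qed

lemma dn_mem': "x \<in> A i \<Longrightarrow> dn k x \<in> A (i - 1)"
proof (cases i)
  case 0
  then show "x \<in> A i \<Longrightarrow> dn k x \<in> A (i - 1)"
    using dn_bottom[of x k] subspace_0[OF subspace_supported_on[of "K 0"]] by simp
qed (simp add: dn_mem)

lemma eq_sum_up:
  assumes "x \<in> A (Suc i)"
  shows "x = (\<Sum>k = 1..n. up k ((1 / real (Suc i)) *\<^sub>R dn k x))"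
proof -
  have "x = (1 / real (Suc i)) *\<^sub>R (\<Sum>k = 1..n. up k (dn k x))"
    unfolding euler[OF assms] by simp
  then show ?thesis
    by (simp only: scaleR_sum_right up_simps(3))
qed

text \<open>
  Induction principle on the degree: by Euler's identity, two linear maps that agree on all
  \<open>up k y\<close> agree in positive degree.
\<close>

lemma linear_eq_up:
  assumes f: "linear f" and g: "linear g"
    and eq: "\<And>k y. k \<in> {1..n} \<Longrightarrow> y \<in> A i \<Longrightarrow> f (up k y) = g (up k y)"
    and x: "x \<in> A (Suc i)"
  shows "f x = g x"
proof -
  define y where "y k = (1 / real (Suc i)) *\<^sub>R dn k x" for k
  have y: "y k \<in> A i" for k
    unfolding y_def by (intro subspace_scale subspace_supported_on dn_mem[OF x])
  have "x = (\<Sum>k = 1..n. up k (y k))"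
    unfolding y_def by (rule eq_sum_up[OF x])
  then show ?thesis
    using eq y by (simp add: linear_sum[OF f] linear_sum[OF g])
qed

lemma linear_maps_up:
  assumes f: "linear f" and S: "subspace S"
    and mem: "\<And>k y. k \<in> {1..n} \<Longrightarrow> y \<in> A i \<Longrightarrow> f (up k y) \<in> S"
    and x: "x \<in> A (Suc i)"
  shows "f x \<in> S"
proof -
  have "f x = (\<Sum>k = 1..n. f (up k ((1 / real (Suc i)) *\<^sub>R dn k x)))"
    using eq_sum_up[OF x] linear_sum[OF f] by metis
  also have "\<dots> \<in> S"
    using dn_mem[OF x] by (intro subspace_sum S mem subspace_scale subspace_supported_on) auto
  finally show ?thesis .
qed

lemma dn_dn:
  assumes k: "k \<in> {1..n}" and l: "l \<in> {1..n}"
  shows "x \<in> A i \<Longrightarrow> dn k (dn l x) = e *\<^sub>R dn l (dn k x)"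
proof (induction i arbitrary: x)
  case 0
  then show ?case
    by (simp add: dn_bottom dn_simps)
next
  case (Suc i)
  show ?case
  proof (rule linear_eq_up[OF _ _ _ Suc.prems])
    show "linear (\<lambda>x. dn k (dn l x))"
      by (rule linear_compose[OF linear_dn linear_dn, unfolded o_def])
    show "linear (\<lambda>x. e *\<^sub>R dn l (dn k x))"
      by (intro linear_compose_scale_right linear_compose[OF linear_dn linear_dn, unfolded o_def])
    fix p y assume p: "p \<in> {1..n}" and y: "y \<in> A i"
    have *: "dn k (dn l (up p y)) = up p (dn k (dn l y))
        + e *\<^sub>R (if k = p then dn l y else 0) + (if l = p then dn k y else 0)"
      if "k \<in> {1..n}" "l \<in> {1..n}" for k l
      using e_square by (simp add: dn_up[OF that(2) p y] dn_up[OF that(1) p dn_mem'[OF y]]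
          dn_simps scaleR_add_right)
    show "dn k (dn l (up p y)) = e *\<^sub>R dn l (dn k (up p y))"
      unfolding *[OF k l] *[OF l k] Suc.IH[OF y] using e_square
      by (simp add: up_simps scaleR_add_right)
  qed
qed

lemma perm_A_0: "\<sigma> permutes {1..n} \<Longrightarrow> x \<in> A 0 \<Longrightarrow> perm \<sigma> x = x"
  by (erule A_0_eq) (simp add: perm_simps perm_vacuum)

lemma perm_mem:
  assumes "\<sigma> permutes {1..n}"
  shows "x \<in> A i \<Longrightarrow> perm \<sigma> x \<in> A i"
proof (induction i arbitrary: x)
  case 0
  then show ?case
    by (simp only: perm_A_0[OF assms])
next
  case (Suc i)
  show ?case
  proof (rule linear_maps_up[OF linear_perm subspace_supported_on _ Suc.prems])
    fix k y assume "k \<in> {1..n}" "y \<in> A i"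
    then show "perm \<sigma> (up k y) \<in> A (Suc i)"
      using permutes_in_image[OF assms, of k] by (simp add: perm_up[OF assms] up_mem Suc.IH del: atLeastAtMost_iff)
  qed
qed

lemma perm_dn:
  assumes \<sigma>: "\<sigma> permutes {1..n}" and k: "k \<in> {1..n}"
  shows "x \<in> A i \<Longrightarrow> perm \<sigma> (dn k x) = dn (\<sigma> k) (perm \<sigma> x)"
proof (induction i arbitrary: x)
  case 0
  then show ?case
    by (simp add: perm_A_0[OF \<sigma>] dn_bottom perm_simps)
next
  case (Suc i)
  show ?case
  proof (rule linear_eq_up[OF _ _ _ Suc.prems])
    show "linear (\<lambda>x. perm \<sigma> (dn k x))"
      by (rule linear_compose[OF linear_dn linear_perm, unfolded o_def])
    show "linear (\<lambda>x. dn (\<sigma> k) (perm \<sigma> x))"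
      by (rule linear_compose[OF linear_perm linear_dn, unfolded o_def])
    fix p y assume p: "p \<in> {1..n}" and y: "y \<in> A i"
    have in_range: "\<sigma> k \<in> {1..n}" "\<sigma> p \<in> {1..n}"
      using permutes_in_image[OF \<sigma>] k p by blast+
    have inj: "\<sigma> k = \<sigma> p \<longleftrightarrow> k = p"
      using permutes_inj[OF \<sigma>] by (simp add: inj_eq)
    show "perm \<sigma> (dn k (up p y)) = dn (\<sigma> k) (perm \<sigma> (up p y))"
      using Suc.IH[OF y]
      by (simp add: dn_up[OF k p y] perm_up[OF \<sigma> p y] dn_up[OF in_range perm_mem[OF \<sigma> y]]
          perm_up[OF \<sigma> p dn_mem'[OF y]] perm_simps inj)
  qed
qed

lemma pair_perm:
  assumes \<sigma>: "\<sigma> permutes {1..n}"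
  shows "x \<in> A i \<Longrightarrow> y \<in> A i \<Longrightarrow> pair (perm \<sigma> x) (perm \<sigma> y) = pair x y"
proof (induction i arbitrary: x y)
  case 0
  then show ?case
    by (simp add: perm_A_0[OF \<sigma>])
next
  case (Suc i)
  show ?case
  proof (rule linear_eq_up[OF _ _ _ Suc.prems(1)])
    show "linear (\<lambda>x. pair (perm \<sigma> x) (perm \<sigma> y))"
      by (rule linear_compose[OF linear_perm pair_linear(2), unfolded o_def])
    show "linear (\<lambda>x. pair x y)"
      by (rule pair_linear)
    fix k u assume k: "k \<in> {1..n}" and u: "u \<in> A i"
    have \<sigma>k: "\<sigma> k \<in> {1..n}"
      using permutes_in_image[OF \<sigma>] k by blast
    have "pair (perm \<sigma> (up k u)) (perm \<sigma> y) = pair (perm \<sigma> u) (perm \<sigma> (dn k y))"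
      by (simp add: perm_up[OF \<sigma> k u] perm_dn[OF \<sigma> k Suc.prems(2)]
          pair_up[OF \<sigma>k perm_mem[OF \<sigma> u] perm_mem[OF \<sigma> Suc.prems(2)]])
    also have "\<dots> = pair (up k u) y"
      using Suc.IH[OF u dn_mem[OF Suc.prems(2)]] by (simp add: pair_up[OF k u Suc.prems(2)])
    finally show "pair (perm \<sigma> (up k u)) (perm \<sigma> y) = pair (up k u) y" .
  qed
qed

text \<open>
  Euler's identity and adjointness express \<open>pair\<close> through its values in the degree below, in a form
  that is symmetric in \<open>x\<close> and \<open>y\<close>. Symmetry and positivity propagate along this formula.
\<close>

lemma pair_euler:
  assumes "x \<in> A i" "y \<in> A i"
  shows "real i * pair x y = (\<Sum>k = 1..n. pair (dn k x) (dn k y))"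
proof (cases i)
  case 0
  with assms show ?thesis
    by (simp add: dn_bottom bilinear_lzero[OF bilinear_pair])
next
  case (Suc j)
  have "real i * pair x y = pair (real i *\<^sub>R x) y"
    by (simp add: linear_scale[OF pair_linear(2)])
  also have "\<dots> = (\<Sum>k = 1..n. pair (up k (dn k x)) y)"
    by (simp only: euler[OF assms(1), symmetric] linear_sum[OF pair_linear(2)])
  also have "\<dots> = (\<Sum>k = 1..n. pair (dn k x) (dn k y))"
    using assms Suc by (intro sum.cong refl pair_up) (auto intro: dn_mem)
  finally show ?thesis .
qed

section \<open>The representation of sl2 on the tensor square\<close>

definition L :: "('k \<times> 'k \<Rightarrow>\<^sub>0 real) \<Rightarrow> ('k \<times> 'k \<Rightarrow>\<^sub>0 real)" where
  "L x = (\<Sum>k = 1..n. tensor_map (up k) (dn k) x)"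

definition M :: "('k \<times> 'k \<Rightarrow>\<^sub>0 real) \<Rightarrow> ('k \<times> 'k \<Rightarrow>\<^sub>0 real)" where
  "M x = tensor_swap (L (tensor_swap x))"

definition dl :: "nat \<Rightarrow> ('k \<times> 'k \<Rightarrow>\<^sub>0 real) \<Rightarrow> ('k \<times> 'k \<Rightarrow>\<^sub>0 real)" where
  "dl k = tensor_map (dn k) (\<lambda>v. v)"

definition dr :: "nat \<Rightarrow> ('k \<times> 'k \<Rightarrow>\<^sub>0 real) \<Rightarrow> ('k \<times> 'k \<Rightarrow>\<^sub>0 real)" where
  "dr k = tensor_map (\<lambda>u. u) (dn k)"

lemma linear_L: "linear L"
  unfolding L_def[abs_def] by (intro linear_compose_sum ballI linear_tensor_map)

lemma linear_M: "linear M"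
  unfolding M_def[abs_def]
  by (intro linear_compose[OF linear_tensor_swap
        linear_compose[OF linear_L linear_tensor_swap], unfolded o_def])

lemma linear_dl: "linear (dl k)" and linear_dr: "linear (dr k)"
  by (simp_all add: dl_def dr_def linear_tensor_map)

lemmas L_simps = linear_0[OF linear_L] linear_add[OF linear_L] linear_scale[OF linear_L]
lemmas M_simps = linear_0[OF linear_M] linear_add[OF linear_M] linear_scale[OF linear_M]
lemmas dl_simps = linear_0[OF linear_dl] linear_add[OF linear_dl] linear_scale[OF linear_dl]
  linear_sum[OF linear_dl]
lemmas dr_simps = linear_0[OF linear_dr] linear_add[OF linear_dr] linear_scale[OF linear_dr]
  linear_sum[OF linear_dr]
lemmas swap_simps = linear_0[OF linear_tensor_swap] linear_add[OF linear_tensor_swap]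
  linear_scale[OF linear_tensor_swap] linear_sum[OF linear_tensor_swap]

lemma L_tensor: "L (u \<otimes>\<^sub>t v) = (\<Sum>k = 1..n. up k u \<otimes>\<^sub>t dn k v)"
  by (simp add: L_def tensor_map_tensor linear_up linear_dn)

lemma M_tensor: "M (u \<otimes>\<^sub>t v) = (\<Sum>k = 1..n. dn k u \<otimes>\<^sub>t up k v)"
  by (simp add: M_def L_tensor swap_simps)

lemma dl_tensor: "dl k (u \<otimes>\<^sub>t v) = dn k u \<otimes>\<^sub>t v"
  by (simp add: dl_def tensor_map_tensor linear_dn linear_ident)

lemma dr_tensor: "dr k (u \<otimes>\<^sub>t v) = u \<otimes>\<^sub>t dn k v"
  by (simp add: dr_def tensor_map_tensor linear_dn linear_ident)

lemma W_0: "0 \<in> W i j"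
  by (rule subspace_0[OF subspace_supported_on])

lemma L_mem: "x \<in> W i (Suc j) \<Longrightarrow> L x \<in> W (Suc i) j"
  by (rule linear_maps_tensor[OF linear_L subspace_supported_on])
     (auto simp: L_tensor intro!: subspace_sum subspace_supported_on tensor_supported_on up_mem dn_mem)

lemma L_top: "x \<in> W i 0 \<Longrightarrow> L x = 0"
  by (rule linear_eq_tensor[OF linear_L linear_zero])
     (simp_all only: L_tensor dn_bottom tensor_simps sum.neutral_const)

lemma M_mem: "x \<in> W (Suc i) j \<Longrightarrow> M x \<in> W i (Suc j)"
  unfolding M_def by (intro tensor_swap_mem L_mem)

lemma M_bottom: "x \<in> W 0 j \<Longrightarrow> M x = 0"
  unfolding M_def by (simp only: L_top[OF tensor_swap_mem] swap_simps)

lemma dl_mem: "x \<in> W (Suc i) j \<Longrightarrow> dl k x \<in> W i j"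
  by (rule linear_maps_tensor[OF linear_dl subspace_supported_on])
     (simp_all add: dl_tensor tensor_supported_on dn_mem)

lemma dr_mem: "x \<in> W i (Suc j) \<Longrightarrow> dr k x \<in> W i j"
  by (rule linear_maps_tensor[OF linear_dr subspace_supported_on])
     (simp_all add: dr_tensor tensor_supported_on dn_mem)

lemma dl_bottom: "x \<in> W 0 j \<Longrightarrow> dl k x = 0"
  by (rule linear_eq_tensor[OF linear_dl linear_zero])
     (simp_all only: dl_tensor dn_bottom tensor_simps)

lemma dl_swap: "dl k (tensor_swap x) = tensor_swap (dr k x)"
proof (rule linear_eq_tensor[of "\<lambda>x. dl k (tensor_swap x)" "\<lambda>x. tensor_swap (dr k x)" UNIV UNIV])
  show "linear (\<lambda>x. dl k (tensor_swap x))" "linear (\<lambda>x. tensor_swap (dr k x))"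
    by (simp_all add: linear_iff dl_simps dr_simps swap_simps)
qed (simp_all add: dl_tensor dr_tensor supported_on_def)

lemma dr_swap: "dr k (tensor_swap x) = tensor_swap (dl k x)"
  by (metis dl_swap tensor_swap_swap)

text \<open>
  Moving the annihilation operators past the creation operators turns both products into the same
  double sum \<open>S\<close> with coefficients \<open>e\<close>, plus the number operator of the left factor for \<open>L M\<close> and
  that of the right factor for \<open>M L\<close>.
\<close>

lemma commutator:
  assumes "x \<in> W i j"
  shows "L (M x) = M (L x) + (real i - real j) *\<^sub>R x"
proof (rule linear_eq_tensor[OF _ _ _ assms])
  show "linear (\<lambda>x. L (M x))" "linear (\<lambda>x. M (L x) + (real i - real j) *\<^sub>R x)"
    by (simp_all add: linear_iff L_simps M_simps scaleR_add_right)
  fix u v assume u: "u \<in> A i" and v: "v \<in> A j"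
  let ?S = "\<Sum>k = 1..n. \<Sum>l = 1..n. e *\<^sub>R (up k (dn l u) \<otimes>\<^sub>t up l (dn k v))"
  have "L (M (u \<otimes>\<^sub>t v)) = (\<Sum>l = 1..n. \<Sum>k = 1..n. up k (dn l u) \<otimes>\<^sub>t dn k (up l v))"
    by (simp add: M_tensor L_tensor linear_sum[OF linear_L])
  also have "\<dots> = (\<Sum>l = 1..n. \<Sum>k = 1..n. e *\<^sub>R (up k (dn l u) \<otimes>\<^sub>t up l (dn k v))
      + (if k = l then up k (dn l u) \<otimes>\<^sub>t v else 0))"
    by (intro sum.cong refl) (simp add: dn_up[OF _ _ v] tensor_simps)
  also have "\<dots> = ?S + (\<Sum>k = 1..n. up k (dn k u)) \<otimes>\<^sub>t v"
    by (simp add: sum.distrib tensor_sum_left, subst sum.swap) simp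
  finally have lm: "L (M (u \<otimes>\<^sub>t v)) = ?S + real i *\<^sub>R (u \<otimes>\<^sub>t v)"
    by (simp only: euler[OF u] tensor_simps)
  have "M (L (u \<otimes>\<^sub>t v)) = (\<Sum>k = 1..n. \<Sum>l = 1..n. dn l (up k u) \<otimes>\<^sub>t up l (dn k v))"
    by (simp add: M_tensor L_tensor linear_sum[OF linear_M])
  also have "\<dots> = (\<Sum>k = 1..n. \<Sum>l = 1..n. e *\<^sub>R (up k (dn l u) \<otimes>\<^sub>t up l (dn k v))
      + (if l = k then u \<otimes>\<^sub>t up l (dn k v) else 0))"
    by (intro sum.cong refl) (simp add: dn_up[OF _ _ u] tensor_simps)
  also have "\<dots> = ?S + u \<otimes>\<^sub>t (\<Sum>k = 1..n. up k (dn k v))"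
    by (simp add: sum.distrib tensor_sum_right)
  finally have ml: "M (L (u \<otimes>\<^sub>t v)) = ?S + real j *\<^sub>R (u \<otimes>\<^sub>t v)"
    by (simp only: euler[OF v] tensor_simps)
  show "L (M (u \<otimes>\<^sub>t v)) = M (L (u \<otimes>\<^sub>t v)) + (real i - real j) *\<^sub>R (u \<otimes>\<^sub>t v)"
    unfolding lm ml by (simp add: scaleR_diff_left)
qed

sublocale sl2: bigraded_sl2 W L M
  by (rule bigraded_sl2.intro)
    (simp_all only: subspace_supported_on linear_L linear_M L_mem L_top M_mem M_bottom commutator)

section \<open>The swap on primitive vectors\<close>

lemma dl_L:
  assumes "x \<in> W i j" and k: "k \<in> {1..n}"
  shows "dl k (L x) = e *\<^sub>R L (dl k x) + dr k x"
proof (rule linear_eq_tensor[OF _ _ _ assms(1)])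
  show "linear (\<lambda>x. dl k (L x))" "linear (\<lambda>x. e *\<^sub>R L (dl k x) + dr k x)"
    by (simp_all add: linear_iff L_simps dl_simps dr_simps scaleR_add_right)
  fix u v assume u: "u \<in> A i"
  have "dl k (L (u \<otimes>\<^sub>t v)) = (\<Sum>l = 1..n. dn k (up l u) \<otimes>\<^sub>t dn l v)"
    by (simp add: L_tensor dl_simps dl_tensor)
  also have "\<dots> = (\<Sum>l = 1..n. e *\<^sub>R (up l (dn k u) \<otimes>\<^sub>t dn l v) + (if k = l then u \<otimes>\<^sub>t dn l v else 0))"
    by (intro sum.cong refl) (simp add: dn_up[OF k _ u] tensor_simps)
  also have "\<dots> = e *\<^sub>R L (dl k (u \<otimes>\<^sub>t v)) + dr k (u \<otimes>\<^sub>t v)"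
    using k by (simp add: sum.distrib dl_tensor dr_tensor L_tensor scaleR_sum_right)
  finally show "dl k (L (u \<otimes>\<^sub>t v)) = e *\<^sub>R L (dl k (u \<otimes>\<^sub>t v)) + dr k (u \<otimes>\<^sub>t v)" .
qed

lemma dr_L:
  assumes "x \<in> W i j" and k: "k \<in> {1..n}"
  shows "dr k (L x) = e *\<^sub>R L (dr k x)"
proof (rule linear_eq_tensor[OF _ _ _ assms(1)])
  show "linear (\<lambda>x. dr k (L x))" "linear (\<lambda>x. e *\<^sub>R L (dr k x))"
    by (simp_all add: linear_iff L_simps dr_simps scaleR_add_right)
  fix u v assume v: "v \<in> A j"
  show "dr k (L (u \<otimes>\<^sub>t v)) = e *\<^sub>R L (dr k (u \<otimes>\<^sub>t v))"
    by (simp add: L_tensor dr_simps dr_tensor dn_dn[OF k _ v] tensor_simps scaleR_sum_right)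
qed

lemma dl_M:
  assumes "x \<in> W i j" and k: "k \<in> {1..n}"
  shows "dl k (M x) = e *\<^sub>R M (dl k x)"
  using dr_L[OF tensor_swap_mem[OF assms(1)] k] by (simp add: M_def dl_swap dr_swap swap_simps)

lemma dr_M:
  assumes "x \<in> W i j" and k: "k \<in> {1..n}"
  shows "dr k (M x) = e *\<^sub>R M (dr k x) + dl k x"
  using dl_L[OF tensor_swap_mem[OF assms(1)] k] by (simp add: M_def dl_swap dr_swap swap_simps)

lemma L_pow_graded:
  assumes "x \<in> W i j"
  obtains i' j' where "(L ^^ s) x \<in> W i' j'"
  using sl2.L_pow_mem'[OF assms, of s] sl2.L_pow_eq_0[OF assms, of s] W_0
  by (cases "s \<le> j") (auto simp: not_le)

lemma dr_L_pow:
  assumes x: "x \<in> W i j" and k: "k \<in> {1..n}"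
  shows "dr k ((L ^^ s) x) = e ^ s *\<^sub>R (L ^^ s) (dr k x)"
proof (induction s)
  case (Suc s)
  obtain i' j' where "(L ^^ s) x \<in> W i' j'"
    by (rule L_pow_graded[OF x])
  from dr_L[OF this k] Suc show ?case
    by (simp add: L_simps)
qed simp

lemma dl_L_pow:
  assumes x: "x \<in> W i j" and k: "k \<in> {1..n}"
  shows "dl k ((L ^^ Suc s) x)
    = e ^ Suc s *\<^sub>R (L ^^ Suc s) (dl k x) + (real (Suc s) * e ^ s) *\<^sub>R (L ^^ s) (dr k x)"
proof (induction s)
  case 0
  show ?case
    using dl_L[OF x k] by simp
next
  case (Suc s)
  obtain i' j' where "(L ^^ Suc s) x \<in> W i' j'"
    by (rule L_pow_graded[OF x])
  then have "dl k ((L ^^ Suc (Suc s)) x)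
      = e *\<^sub>R L (dl k ((L ^^ Suc s) x)) + dr k ((L ^^ Suc s) x)"
    using dl_L[OF _ k] by simp
  also have "\<dots> = e ^ Suc (Suc s) *\<^sub>R (L ^^ Suc (Suc s)) (dl k x)
      + (e * (real (Suc s) * e ^ s) + e ^ Suc s) *\<^sub>R (L ^^ Suc s) (dr k x)"
    unfolding Suc dr_L_pow[OF x k] by (simp add: L_simps scaleR_add_right scaleR_add_left)
  also have "e * (real (Suc s) * e ^ s) + e ^ Suc s = real (Suc (Suc s)) * e ^ Suc s"
    by (simp add: algebra_simps)
  finally show ?case .
qed

lemma euler_left:
  assumes "x \<in> W i j"
  shows "(\<Sum>k = 1..n. tensor_map (up k) (\<lambda>v. v) (dl k x)) = real i *\<^sub>R x"
proof (rule linear_eq_tensor[OF _ _ _ assms])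
  show "linear (\<lambda>x. \<Sum>k = 1..n. tensor_map (up k) (\<lambda>v. v) (dl k x))"
    by (intro linear_compose_sum ballI linear_compose[OF linear_dl linear_tensor_map, unfolded o_def])
  show "linear (\<lambda>x. real i *\<^sub>R x)"
    by (simp add: linear_iff scaleR_add_right)
  fix u v assume "u \<in> A i"
  from euler[OF this] show "(\<Sum>k = 1..n. tensor_map (up k) (\<lambda>v. v) (dl k (u \<otimes>\<^sub>t v))) = real i *\<^sub>R (u \<otimes>\<^sub>t v)"
    by (simp add: dl_tensor tensor_map_tensor linear_up linear_ident flip: tensor_sum_left)
      (simp add: tensor_simps)
qed

lemma eq_0_of_dl:
  assumes x: "x \<in> W (Suc i) j" and "\<And>k. k \<in> {1..n} \<Longrightarrow> dl k x = 0"
  shows "x = 0"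
  using euler_left[OF x] assms(2) by (simp add: linear_0[OF linear_tensor_map])

lemma eq_0_of_dr:
  assumes x: "x \<in> W i (Suc j)" and "\<And>k. k \<in> {1..n} \<Longrightarrow> dr k x = 0"
  shows "x = 0"
proof -
  have "tensor_swap x = 0"
    by (rule eq_0_of_dl[OF tensor_swap_mem[OF x]]) (simp add: dl_swap assms(2) swap_simps)
  then show ?thesis
    by (metis tensor_swap_swap swap_simps(1))
qed

lemma W_0_0_eq:
  assumes "x \<in> W 0 0"
  obtains c where "x = c *\<^sub>R (bvec z \<otimes>\<^sub>t bvec z)"
proof
  have "x = lin_ext bvec x"
    by (simp add: bvec_expansion)
  also have "\<dots> = (\<Sum>p\<in>{(z, z)}. Poly_Mapping.lookup x p *\<^sub>R bvec p)"
    using assms by (intro lin_ext_superset) (auto simp: K_0 supported_on_def)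
  finally show "x = Poly_Mapping.lookup x (z, z) *\<^sub>R (bvec z \<otimes>\<^sub>t bvec z)"
    by simp
qed

lemma swap_W_0_0: "x \<in> W 0 0 \<Longrightarrow> tensor_swap x = x"
  by (erule W_0_0_eq) (simp only: swap_simps tensor_swap_tensor)

lemma choose_two_Suc: "Suc m choose 2 = m + (m choose 2)"
  by (simp add: numeral_2_eq_2)

text \<open>
  The case \<open>i = 0\<close> of the following theorem. The left annihilation operators vanish here, so the
  induction on \<open>r\<close> compares both sides after applying \<open>dr k\<close>. This operator becomes \<open>dl k\<close> inside the
  swap, and moving \<open>dl k\<close> through \<open>L\<^bsup>r+1\<^esup>\<close> leaves \<open>r + 1\<close> copies of \<open>L\<^sup>r (dr k x)\<close>, each with the factor
  \<open>e\<^sup>r\<close>.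
\<close>

lemma swap_L_pow_bottom:
  "x \<in> W 0 r \<Longrightarrow> tensor_swap ((L ^^ r) x) = (e ^ (r choose 2) * fact r) *\<^sub>R x"
proof (induction r arbitrary: x)
  case 0
  then show ?case
    by (simp add: swap_W_0_0 binomial_eq_0)
next
  case (Suc r)
  let ?c = "e ^ (Suc r choose 2) * fact (Suc r)"
  have "tensor_swap ((L ^^ Suc r) x) - ?c *\<^sub>R x = 0"
  proof (rule eq_0_of_dr)
    show "tensor_swap ((L ^^ Suc r) x) - ?c *\<^sub>R x \<in> W 0 (Suc r)"
      using Suc.prems tensor_swap_mem[OF sl2.L_pow_mem[of x 0 0 "Suc r"]]
      by (intro subspace_diff subspace_scale subspace_supported_on) simp_all
    fix k assume k: "k \<in> {1..n}"
    have "dr k (tensor_swap ((L ^^ Suc r) x)) = tensor_swap ((real (Suc r) * e ^ r) *\<^sub>R (L ^^ r) (dr k x))"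
      using dl_L_pow[OF Suc.prems k, of r] dl_bottom[OF Suc.prems]
      by (simp only: dr_swap sl2.L_pow_simps) simp
    also have "\<dots> = ?c *\<^sub>R dr k x"
      using Suc.IH[OF dr_mem[OF Suc.prems]]
      by (simp add: swap_simps choose_two_Suc power_add mult_ac)
    finally show "dr k (tensor_swap ((L ^^ Suc r) x) - ?c *\<^sub>R x) = 0"
      by (simp only: linear_diff[OF linear_dr] dr_simps) simp
  qed
  then show ?case
    by (simp only: right_minus_eq)
qed

text \<open>
  Both sides have the same bidegree, so it suffices to compare them after applying \<open>dl k\<close>, which
  becomes \<open>dr k\<close> inside the swap and \<open>e\<close>-commutes with \<open>L\<close>. Thus \<open>L\<^sup>r (dr k x)\<close> is needed. The vector
  \<open>dr k x\<close> is not of lowest weight, but \<open>M (dr k x) = - e * dl k x\<close>, and \<open>dl k x\<close> is of lowest weight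
  \<open>-(r+1)\<close> and bidegree \<open>(i, i + r + 1)\<close>. Subtracting the right multiple
  of \<open>L (dl k x)\<close> therefore gives a lowest weight vector of weight \<open>-(r-1)\<close>, which \<open>L\<^sup>r\<close> kills. So \<open>L\<^sup>r (dr k x)\<close> is a multiple of
  \<open>L\<^bsup>r+1\<^esup> (dl k x)\<close>, to which the induction hypothesis applies. The sign changes by
  \<open>- e\<^bsup>r+1\<^esup>\<close> in each step.
\<close>

theorem swap_L_pow_primitive:
  "x \<in> W i (i + r) \<Longrightarrow> M x = 0 \<Longrightarrow>
    tensor_swap ((L ^^ r) x) = ((-1) ^ i * e ^ ((2 * i + r) choose 2) * fact r) *\<^sub>R x"
proof (induction i arbitrary: x r)
  case 0
  then show ?case
    using swap_L_pow_bottom[of x r] by simp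
next
  case (Suc i)
  let ?c = "(-1) ^ Suc i * e ^ ((2 * Suc i + r) choose 2) * fact r"
  have x: "x \<in> W (Suc i) (Suc (i + r))"
    using Suc.prems by simp
  have "tensor_swap ((L ^^ r) x) - ?c *\<^sub>R x = 0"
  proof (rule eq_0_of_dl)
    show "tensor_swap ((L ^^ r) x) - ?c *\<^sub>R x \<in> W (Suc i) (Suc (i + r))"
      using x tensor_swap_mem[OF sl2.L_pow_mem[OF Suc.prems(1)]]
      by (intro subspace_diff subspace_scale subspace_supported_on) simp_all
    fix k assume k: "k \<in> {1..n}"
    (* the coefficient for which M kills dr k x + q * L (dl k x) *)
    define q where "q = e / real (Suc r)"
    have dlx: "dl k x \<in> W i (i + Suc r)"
      using dl_mem[OF x, of k] by simp
    have Mdl: "M (dl k x) = 0"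
      using dl_M[OF x k] Suc.prems(2) e_square by (auto simp: dl_simps)
    have "e *\<^sub>R M (dr k x) = - dl k x"
      using dr_M[OF x k] Suc.prems(2) by (simp add: dr_simps add_eq_0_iff)
    then have "(e * e) *\<^sub>R M (dr k x) = - e *\<^sub>R dl k x"
      by (simp flip: scaleR_scaleR)
    then have Mdr: "M (dr k x) = - e *\<^sub>R dl k x"
      by (simp add: e_square)
    have MLdl: "M (L (dl k x)) = real (Suc r) *\<^sub>R dl k x"
      using commutator[OF dlx] Mdl by (simp add: L_simps eq_neg_iff_add_eq_0 algebra_simps)
    have "M (dr k x + q *\<^sub>R L (dl k x)) = 0"
      by (simp add: M_simps Mdr MLdl q_def)
    moreover have "dr k x + q *\<^sub>R L (dl k x) \<in> W (Suc i) (i + r)"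
      using dr_mem[OF x] L_mem[of "dl k x" i "i + r"] dlx
      by (intro subspace_add subspace_scale subspace_supported_on) simp_all
    ultimately have "(L ^^ r) (dr k x + q *\<^sub>R L (dl k x)) = 0"
      using sl2.L_pow_eq_0_of_M_eq_0 by blast
    then have "(L ^^ r) (dr k x) = - q *\<^sub>R (L ^^ Suc r) (dl k x)"
      by (simp add: sl2.L_pow_simps funpow_swap1 eq_neg_iff_add_eq_0)
    then have "dl k (tensor_swap ((L ^^ r) x)) = (- (e ^ r * q)) *\<^sub>R tensor_swap ((L ^^ Suc r) (dl k x))"
      by (simp only: dl_swap dr_L_pow[OF x k] swap_simps scaleR_scaleR) simp
    also have "\<dots> = (- (e ^ r * q) * ((-1) ^ i * e ^ ((2 * i + Suc r) choose 2) * fact (Suc r))) *\<^sub>R dl k x"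
      by (simp only: Suc.IH[OF dlx Mdl] scaleR_scaleR)
    also have "- (e ^ r * q) * ((-1) ^ i * e ^ ((2 * i + Suc r) choose 2) * fact (Suc r)) = ?c"
    proof -
      have "(2 * Suc i + r) choose 2 = 2 * i + Suc r + ((2 * i + Suc r) choose 2)"
        using choose_two_Suc[of "2 * i + Suc r"] by simp
      moreover have "e ^ (2 * i) = 1"
        by (simp add: power_mult power2_eq_square e_square)
      ultimately show ?thesis
        by (simp add: q_def power_add field_simps)
    qed
    finally show "dl k (tensor_swap ((L ^^ r) x) - ?c *\<^sub>R x) = 0"
      by (simp only: linear_diff[OF linear_dl] dl_simps) simp
  qed
  then show ?case
    by (simp only: right_minus_eq)
qed

section \<open>The inner product\<close>

definition form :: "('k \<times> 'k \<Rightarrow>\<^sub>0 real) \<Rightarrow> ('k \<times> 'k \<Rightarrow>\<^sub>0 real) \<Rightarrow> real" where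
  "form = tensor_form pair"

definition inner_prod :: "('k \<times> 'k \<Rightarrow>\<^sub>0 real) \<Rightarrow> ('k \<times> 'k \<Rightarrow>\<^sub>0 real) \<Rightarrow> real" where
  "inner_prod x y = form x (tensor_swap y)"

lemma bilinear_form: "bilinear form"
  by (simp add: form_def bilinear_tensor_form)

lemma bilinear_inner_prod: "bilinear inner_prod"
  unfolding inner_prod_def[abs_def]
  by (rule bilinear_compose2[OF bilinear_form linear_ident linear_tensor_swap])

lemmas inner_prod_linear = bilinear_linear[OF bilinear_inner_prod]

lemma form_tensor: "form (u \<otimes>\<^sub>t v) (u' \<otimes>\<^sub>t v') = pair u v' * pair u' v"
  by (simp add: form_def tensor_form_tensor bilinear_pair)

lemma inner_prod_tensor: "inner_prod (u \<otimes>\<^sub>t v) (u' \<otimes>\<^sub>t v') = pair u u' * pair v' v"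
  by (simp add: inner_prod_def form_tensor)

lemma bilinear_sum_inner_prod:
  assumes "\<And>k. linear (d k)"
  shows "bilinear (\<lambda>x y. \<Sum>k = 1..n. inner_prod (d k x) (d k y))"
  using assms bilinear_inner_prod unfolding bilinear_def linear_iff
  by (simp add: sum.distrib sum_distrib_left)

lemma bilinear_scaled: "bilinear B \<Longrightarrow> bilinear (\<lambda>x y. c * B x y)" for c :: real
  unfolding bilinear_def linear_iff by (simp add: algebra_simps)

lemma inner_prod_dl:
  assumes "x \<in> W i j" "y \<in> W i j"
  shows "real i * inner_prod x y = (\<Sum>k = 1..n. inner_prod (dl k x) (dl k y))"
  by (rule bilinear_eq_tensor[OF bilinear_scaled[OF bilinear_inner_prod]
        bilinear_sum_inner_prod[OF linear_dl] _ assms])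
     (simp add: inner_prod_tensor dl_tensor pair_euler flip: sum_distrib_right mult.assoc)

lemma inner_prod_dr:
  assumes "x \<in> W i j" "y \<in> W i j"
  shows "real j * inner_prod x y = (\<Sum>k = 1..n. inner_prod (dr k x) (dr k y))"
  by (rule bilinear_eq_tensor[OF bilinear_scaled[OF bilinear_inner_prod]
        bilinear_sum_inner_prod[OF linear_dr] _ assms])
     (simp add: inner_prod_tensor dr_tensor pair_euler mult.left_commute flip: sum_distrib_left)

definition inner_product_on :: "('k \<times> 'k \<Rightarrow>\<^sub>0 real) set \<Rightarrow> bool" where
  "inner_product_on X \<longleftrightarrow>
    (\<forall>x\<in>X. \<forall>y\<in>X. inner_prod x y = inner_prod y x) \<and> (\<forall>x\<in>X. x \<noteq> 0 \<longrightarrow> inner_prod x x > 0)"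

text \<open>
  The operators \<open>d k\<close> jointly embed \<open>X\<close> into copies of \<open>Y\<close>, and up to a positive factor the form on
  \<open>X\<close> is the pullback of the sum of the forms on these copies. It is used for \<open>d = dl\<close> and for
  \<open>d = dr\<close>.
\<close>

lemma inner_product_on_step:
  assumes Y: "inner_product_on Y"
    and mem: "\<And>k x. x \<in> X \<Longrightarrow> d k x \<in> Y"
    and det: "\<And>x. x \<in> X \<Longrightarrow> (\<And>k. k \<in> {1..n} \<Longrightarrow> d k x = 0) \<Longrightarrow> x = 0"
    and sum: "\<And>x y. x \<in> X \<Longrightarrow> y \<in> X \<Longrightarrow>
      real (Suc i) * inner_prod x y = (\<Sum>k = 1..n. inner_prod (d k x) (d k y))"
  shows "inner_product_on X"
  unfolding inner_product_on_def
proof (intro conjI ballI impI)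
  fix x y assume xy: "x \<in> X" "y \<in> X"
  have "real (Suc i) * inner_prod x y = real (Suc i) * inner_prod y x"
    unfolding sum[OF xy] sum[OF xy(2,1)]
    using Y mem xy by (intro sum.cong refl) (simp add: inner_product_on_def)
  then show "inner_prod x y = inner_prod y x"
    by simp
next
  fix x assume x: "x \<in> X" "x \<noteq> 0"
  have pos: "inner_prod (d k x) (d k x) > 0" if "d k x \<noteq> 0" for k
    using Y mem[OF x(1)] that by (simp add: inner_product_on_def)
  have nonneg: "inner_prod (d k x) (d k x) \<ge> 0" for k
    using pos[of k] bilinear_lzero[OF bilinear_inner_prod] by (cases "d k x = 0") auto
  obtain k where "k \<in> {1..n}" "d k x \<noteq> 0"
    using det x by blast
  then have "(\<Sum>k = 1..n. inner_prod (d k x) (d k x)) > 0"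
    using pos nonneg by (intro sum_pos2[of _ k]) auto
  then have "real (Suc i) * inner_prod x x > 0"
    using sum[OF x(1) x(1)] by simp
  then show "inner_prod x x > 0"
    by (simp add: zero_less_mult_iff)
qed

lemma inner_product_on_W: "inner_product_on (W i j)"
proof (induction i)
  case 0
  show ?case
  proof (induction j)
    case 0
    have "inner_prod (c *\<^sub>R (bvec z \<otimes>\<^sub>t bvec z)) (c' *\<^sub>R (bvec z \<otimes>\<^sub>t bvec z)) = c * c'" for c c'
      by (simp only: linear_scale[OF inner_prod_linear(1)] linear_scale[OF inner_prod_linear(2)]
          inner_prod_tensor pair_vacuum) simp
    then show ?case
      unfolding inner_product_on_def
      by (auto elim!: W_0_0_eq simp: mult.commute zero_less_mult_iff linorder_neq_iff
          simp del: tensor_bvec)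
  next
    case (Suc j)
    show ?case
      by (rule inner_product_on_step[OF Suc, of _ dr]) (use dr_mem eq_0_of_dr inner_prod_dr in blast)+
  qed
next
  case (Suc i)
  show ?case
    by (rule inner_product_on_step[OF Suc, of _ dl]) (use dl_mem eq_0_of_dl inner_prod_dl in blast)+
qed

lemma inner_prod_commute: "x \<in> W i j \<Longrightarrow> y \<in> W i j \<Longrightarrow> inner_prod x y = inner_prod y x"
  and inner_prod_pos: "x \<in> W i j \<Longrightarrow> x \<noteq> 0 \<Longrightarrow> inner_prod x x > 0"
  using inner_product_on_W[of i j] by (auto simp: inner_product_on_def)

section \<open>Equivariance\<close>

definition act :: "(nat \<Rightarrow> nat) \<Rightarrow> ('k \<times> 'k \<Rightarrow>\<^sub>0 real) \<Rightarrow> ('k \<times> 'k \<Rightarrow>\<^sub>0 real)" where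
  "act \<sigma> = tensor_map (perm \<sigma>) (perm \<sigma>)"

lemma linear_act: "linear (act \<sigma>)"
  by (simp add: act_def linear_tensor_map)

lemma act_tensor: "act \<sigma> (u \<otimes>\<^sub>t v) = perm \<sigma> u \<otimes>\<^sub>t perm \<sigma> v"
  by (simp add: act_def tensor_map_tensor linear_perm)

lemma act_L:
  assumes \<sigma>: "\<sigma> permutes {1..n}" and x: "x \<in> W i j"
  shows "L (act \<sigma> x) = act \<sigma> (L x)"
proof (rule linear_eq_tensor[OF _ _ _ x])
  show "linear (\<lambda>x. L (act \<sigma> x))" "linear (\<lambda>x. act \<sigma> (L x))"
    by (rule linear_compose[OF linear_act linear_L, unfolded o_def]
        linear_compose[OF linear_L linear_act, unfolded o_def])+
  fix u v assume u: "u \<in> A i" and v: "v \<in> A j"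
  have "L (act \<sigma> (u \<otimes>\<^sub>t v)) = (\<Sum>k = 1..n. up (\<sigma> k) (perm \<sigma> u) \<otimes>\<^sub>t dn (\<sigma> k) (perm \<sigma> v))"
    unfolding act_tensor L_tensor by (subst sum.permute[OF \<sigma>]) (simp add: o_def)
  also have "\<dots> = act \<sigma> (L (u \<otimes>\<^sub>t v))"
    unfolding L_tensor linear_sum[OF linear_act] act_tensor
    by (intro sum.cong refl) (simp only: perm_up[OF \<sigma> _ u] perm_dn[OF \<sigma> _ v])
  finally show "L (act \<sigma> (u \<otimes>\<^sub>t v)) = act \<sigma> (L (u \<otimes>\<^sub>t v))" .
qed

lemma act_L_pow:
  assumes \<sigma>: "\<sigma> permutes {1..n}" and x: "x \<in> W i j"
  shows "(L ^^ s) (act \<sigma> x) = act \<sigma> ((L ^^ s) x)"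
proof (induction s)
  case (Suc s)
  obtain i' j' where "(L ^^ s) x \<in> W i' j'"
    by (rule L_pow_graded[OF x])
  from act_L[OF \<sigma> this] Suc show ?case
    by simp
qed simp

lemma form_act:
  assumes \<sigma>: "\<sigma> permutes {1..n}" and x: "x \<in> W i j" and y: "y \<in> W j i"
  shows "form (act \<sigma> x) (act \<sigma> y) = form x y"
  by (rule bilinear_eq_tensor[OF bilinear_compose2[OF bilinear_form linear_act linear_act]
        bilinear_form _ x y])
     (simp only: act_tensor form_tensor pair_perm[OF \<sigma>])

section \<open>The three theorems for a pair of oscillators\<close>

definition piece :: "nat \<Rightarrow> int \<Rightarrow> ('k \<times> 'k \<Rightarrow>\<^sub>0 real) set" where
  "piece = graded_tensor A A"

lemma piece_eq: "i \<le> m \<Longrightarrow> piece m (- int m + 2 * int i) = W i (m - i)"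
  unfolding piece_def by (simp only: graded_tensor_piece span_tensors)

lemma piece_cases:
  obtains (piece) i j where "m = i + j" "d = int i - int j" "piece m d = W i j" "piece m (- d) = W j i"
  | (zero) "\<And>i. i \<le> m \<Longrightarrow> d \<noteq> - int m + 2 * int i" "piece m d = {0}" "piece m (- d) = {0}"
proof (cases "\<exists>i\<le>m. d = - int m + 2 * int i")
  case True
  then obtain i where i: "i \<le> m" "d = - int m + 2 * int i"
    by blast
  then have "piece m (- d) = W (m - i) i"
    using piece_eq[of "m - i" m] by simp
  with i piece_eq[OF i(1)] show ?thesis
    by (intro piece[of i "m - i"]) simp_all
next
  case False
  have neg: "- d \<noteq> - int m + 2 * int i" if "i \<le> m" for i
  proof
    assume "- d = - int m + 2 * int i"
    then have "d = - int m + 2 * int (m - i)"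
      using that by simp
    with False show False
      using diff_le_self by blast
  qed
  show ?thesis
  proof (rule zero)
    show "piece m d = {0}" "piece m (- d) = {0}"
      unfolding piece_def by (intro graded_tensor_zero; use False neg in blast)+
  qed (use False in blast)
qed

text \<open>
  The exchange of the factors maps the piece of degree \<open>d\<close> onto that of degree \<open>-d\<close>, and a non-zero
  \<open>x\<close> pairs positively with its image.
\<close>

theorem poincare_duality:
  assumes c: "c \<noteq> 0"
  shows "poincare_duality n (piece m) act (\<lambda>x y. c * form x y)"
proof -
  have inv: "invariant_form_on n act (piece m d) (piece m (- d)) (\<lambda>x y. c * form x y)" for d
    by (rule piece_cases[of m d])
      (simp_all add: invariant_form_on_def form_act linear_0[OF linear_act])
  have nondeg: "nondegenerate_on (piece m d) (piece m (- d)) (\<lambda>x y. c * form x y)" for d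
  proof (rule piece_cases[of m d])
    fix i j assume eq: "piece m d = W i j" "piece m (- d) = W j i"
    have "x = 0" if x: "x \<in> W i j" and 0: "\<forall>y\<in>W j i. form x y = 0" for x
    proof (rule ccontr)
      assume "x \<noteq> 0"
      from inner_prod_pos[OF x this] 0 tensor_swap_mem[OF x] show False
        by (simp add: inner_prod_def)
    qed
    moreover have "y = 0" if y: "y \<in> W j i" and 0: "\<forall>x\<in>W i j. form x y = 0" for y
    proof (rule ccontr)
      assume "y \<noteq> 0"
      then have "tensor_swap y \<noteq> 0"
        by (metis swap_simps(1) tensor_swap_swap)
      from inner_prod_pos[OF tensor_swap_mem[OF y] this] 0 tensor_swap_mem[OF y] show False
        by (simp add: inner_prod_def)
    qed
    ultimately show ?thesis
      using c by (simp add: nondegenerate_on_def eq)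
  qed (simp add: nondegenerate_on_def)
  show ?thesis
    unfolding poincare_duality_def
    using bilinear_scaled[OF bilinear_form] inv nondeg by blast
qed

theorem hard_lefschetz: "hard_lefschetz n (piece m) act L"
proof -
  have L_piece: "L ` piece m d \<subseteq> piece m (d + 2)" for d
  proof (rule piece_cases[of m d])
    fix i j assume eq: "m = i + j" "d = int i - int j" "piece m d = W i j"
    show ?thesis
    proof (cases j)
      case 0
      then have "L ` W i j = {0}"
        using L_top W_0 by (force simp: image_iff)
      moreover have "0 \<in> piece m (d + 2)"
        unfolding piece_def graded_tensor_def by (rule span_zero)
      ultimately show ?thesis
        unfolding eq(3) by simp
    next
      case (Suc k)
      then have "piece m (d + 2) = W (Suc i) k"
        using piece_eq[of "Suc i" m] eq by simp
      then show ?thesis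
        using Suc eq L_mem by auto
    qed
  next
    assume "piece m d = {0}"
    moreover have "0 \<in> piece m (d + 2)"
      unfolding piece_def graded_tensor_def by (rule span_zero)
    ultimately show ?thesis
      by (simp add: L_simps)
  qed
  have equi: "equivariant_map_on n act (piece m d) L" for d
    by (rule piece_cases[of m d])
      (simp_all add: equivariant_map_on_def act_L linear_0[OF linear_act] L_simps)
  have bij: "bij_betw (L ^^ r) (piece m (- int r)) (piece m (int r))" for r
  proof (rule piece_cases[of m "- int r"])
    fix i j assume eq: "m = i + j" "- int r = int i - int j" "piece m (- int r) = W i j"
      "piece m (- (- int r)) = W j i"
    then have "j = i + r"
      by simp
    with eq show ?thesis
      using sl2.hard_lefschetz_bij[of r i] by simp
  qed (simp add: bij_betw_def sl2.L_pow_simps)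
  show ?thesis
    unfolding hard_lefschetz_def using linear_L L_piece equi bij by blast
qed

text \<open>
  The hypothesis says that the scaling \<open>c\<close> of the form turns the sign
  \<open>(-1)\<^sup>i * e\<^bsup>m choose 2\<^esup>\<close> of \<open>swap_L_pow_primitive\<close> into \<open>(-1)\<^bsup>i-s\<^esup>\<close>.
\<close>

theorem hodge_riemann:
  assumes c: "c * e ^ (m choose 2) = (-1) powi s"
  shows "hodge_riemann n m s (piece m) act (\<lambda>x y. c * form x y) L"
proof -
  have inv: "invariant_form_on n act (W i j) (W i j) (lefschetz_form (\<lambda>x y. c * form x y) L r)"
    if "j = i + r" for i j r
    unfolding invariant_form_on_def lefschetz_form_def
  proof (intro allI impI ballI)
    fix \<sigma> x y assume \<sigma>: "\<sigma> permutes {1..n}" and x: "x \<in> W i j" and y: "y \<in> W i j"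
    have "(L ^^ r) y \<in> W j i"
      using sl2.L_pow_mem[of y i i r] y that by simp
    then show "c * form (act \<sigma> x) ((L ^^ r) (act \<sigma> y)) = c * form x ((L ^^ r) y)"
      by (simp only: act_L_pow[OF \<sigma> y] form_act[OF \<sigma> x])
  qed
  have definite: "signed_definite_on ((-1) powi (int i - s))
      (primitive_part L r (W i j)) (lefschetz_form (\<lambda>x y. c * form x y) L r)"
    if j: "j = i + r" and m: "m = 2 * i + r" for i j r
  proof -
    let ?\<epsilon> = "(-1) powi (int i - s) :: real"
    have eps: "c * ((-1) ^ i * e ^ (m choose 2)) = ?\<epsilon>"
    proof -
      have "c * ((-1) ^ i * e ^ (m choose 2)) = (-1) ^ i * (-1) powi s"
        by (simp only: c[symmetric] mult_ac)
      also have "\<dots> = ?\<epsilon>"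
        by (simp add: power_int_diff power_int_minus divide_inverse flip: power_int_inverse)
      finally show ?thesis .
    qed
    have form: "lefschetz_form (\<lambda>x y. c * form x y) L r x y = ?\<epsilon> * fact r * inner_prod x y"
      if "x \<in> primitive_part L r (W i j)" "y \<in> primitive_part L r (W i j)" for x y
    proof -
      have y: "y \<in> W i (i + r)" "(L ^^ Suc r) y = 0"
        using that j by (simp_all add: primitive_part_def)
      have "form x ((L ^^ r) y) = inner_prod x (tensor_swap ((L ^^ r) y))"
        by (simp add: inner_prod_def)
      also have "\<dots> = ((-1) ^ i * e ^ (m choose 2)) * fact r * inner_prod x y"
        by (simp add: swap_L_pow_primitive[OF y(1) sl2.primitive_imp_M_eq_0[OF y]]
            linear_scale[OF inner_prod_linear(1)] m)
      finally show ?thesis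
        by (simp only: lefschetz_form_def eps[symmetric] mult_ac)
    qed
    have sq: "?\<epsilon> * ?\<epsilon> = 1"
      by (simp add: power_int_mult_distrib flip: power_int_add)
    show ?thesis
      unfolding signed_definite_on_def
    proof (intro conjI ballI impI)
      fix x y assume xy: "x \<in> primitive_part L r (W i j)" "y \<in> primitive_part L r (W i j)"
      then have "x \<in> W i j" "y \<in> W i j"
        by (simp_all add: primitive_part_def)
      then show "lefschetz_form (\<lambda>x y. c * form x y) L r x y = lefschetz_form (\<lambda>x y. c * form x y) L r y x"
        using form[OF xy] form[OF xy(2,1)] inner_prod_commute by simp
    next
      fix x assume x: "x \<in> primitive_part L r (W i j)" "x \<noteq> 0"
      then have "inner_prod x x > 0"
        by (intro inner_prod_pos[of x i j]) (simp_all add: primitive_part_def)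
      moreover have "?\<epsilon> * lefschetz_form (\<lambda>x y. c * form x y) L r x x = fact r * inner_prod x x"
        using sq unfolding form[OF x(1) x(1)] by (metis mult.assoc mult.left_neutral)
      ultimately show "?\<epsilon> * lefschetz_form (\<lambda>x y. c * form x y) L r x x > 0"
        by simp
    qed
  qed
  show ?thesis
    unfolding hodge_riemann_def Let_def
  proof (intro allI impI)
    fix i :: nat assume i: "2 * i \<le> m"
    have "m - i = i + (m - 2 * i)" "m = 2 * i + (m - 2 * i)" "i \<le> m"
      using i by auto
    then show "invariant_form_on n act (piece m (- int m + 2 * int i)) (piece m (- int m + 2 * int i))
          (lefschetz_form (\<lambda>x y. c * form x y) L (m - 2 * i)) \<and>
        signed_definite_on ((-1) powi (int i - s))
          (primitive_part L (m - 2 * i) (piece m (- int m + 2 * int i)))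
          (lefschetz_form (\<lambda>x y. c * form x y) L (m - 2 * i))"
      using inv definite by (simp only: piece_eq)
  qed
qed

end

section \<open>The polynomial oscillator\<close>

definition monomials :: "nat \<Rightarrow> nat \<Rightarrow> (nat \<Rightarrow>\<^sub>0 nat) set" where
  "monomials n i = {\<alpha>. Poly_Mapping.keys \<alpha> \<subseteq> {1..n} \<and>
     (\<Sum>k\<in>Poly_Mapping.keys \<alpha>. Poly_Mapping.lookup \<alpha> k) = i}"

lemma poly_hom_eq: "poly_hom n i = supported_on (monomials n i)"
  by (auto simp: poly_hom_def supported_on_def monomials_def)

text \<open>
  Summing over the fixed set \<open>{1..n}\<close> makes the degree additive in \<open>\<alpha>\<close>.
\<close>

lemma monomials_iff:
  "\<alpha> \<in> monomials n i \<longleftrightarrow> Poly_Mapping.keys \<alpha> \<subseteq> {1..n} \<and> (\<Sum>k = 1..n. Poly_Mapping.lookup \<alpha> k) = i"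
proof -
  have "(\<Sum>k\<in>Poly_Mapping.keys \<alpha>. Poly_Mapping.lookup \<alpha> k) = (\<Sum>k = 1..n. Poly_Mapping.lookup \<alpha> k)"
    if "Poly_Mapping.keys \<alpha> \<subseteq> {1..n}"
    using that by (intro sum.mono_neutral_left) (auto simp: in_keys_iff)
  then show ?thesis
    by (auto simp: monomials_def)
qed

lemma monomials_0: "monomials n 0 = {0}"
proof -
  have "\<alpha> = 0" if "\<alpha> \<in> monomials n 0" for \<alpha>
    using that unfolding monomials_def
    by (intro poly_mapping_eqI) (auto simp: in_keys_iff)
  then show ?thesis
    by (auto simp: monomials_def)
qed

lemma single_add_monomials:
  assumes "k \<in> {1..n}"
  shows "Poly_Mapping.single k 1 + \<alpha> \<in> monomials n (Suc i) \<longleftrightarrow> \<alpha> \<in> monomials n i"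
proof -
  have "Poly_Mapping.keys (Poly_Mapping.single k 1 + \<alpha>) = insert k (Poly_Mapping.keys \<alpha>)"
    by (auto simp: in_keys_iff lookup_add lookup_single when_def split: if_splits)
  moreover have "(\<Sum>l = 1..n. Poly_Mapping.lookup (Poly_Mapping.single k 1 + \<alpha>) l)
      = Suc (\<Sum>l = 1..n. Poly_Mapping.lookup \<alpha> l)"
    using assms by (simp add: lookup_add sum.distrib lookup_single when_def)
  ultimately show ?thesis
    using assms by (auto simp: monomials_iff)
qed

lemma single_add_diff:
  assumes "Poly_Mapping.lookup \<alpha> k \<noteq> 0"
  shows "Poly_Mapping.single k 1 + (\<alpha> - Poly_Mapping.single k (1::nat)) = \<alpha>"
  using assms by (intro poly_mapping_eqI) (auto simp: lookup_add lookup_minus lookup_single when_def)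

lemma pdiff_bvec:
  "pdiff k (bvec \<alpha>) = Poly_Mapping.single (\<alpha> - Poly_Mapping.single k 1) (real (Poly_Mapping.lookup \<alpha> k))"
  by (simp add: pdiff_def)

lemma pvar_mult_pdiff_bvec:
  "pvar k * pdiff k (bvec \<alpha>) = real (Poly_Mapping.lookup \<alpha> k) *\<^sub>R bvec \<alpha>"
proof (cases "Poly_Mapping.lookup \<alpha> k = 0")
  case False
  then show ?thesis
    unfolding pdiff_bvec pvar_def mult_single single_add_diff[OF False] scaleR_single by simp
qed (simp add: pdiff_bvec)

lemma poly_oscillator:
  "oscillator n 1 (monomials n) 0 (\<lambda>k d. pvar k * d) pdiff poly_pair poly_perm"
proof (rule oscillator.intro)
  fix k i x assume k: "k \<in> {1..n}" and x: "x \<in> supported_on (monomials n i)"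
  show "pvar k * x \<in> supported_on (monomials n (Suc i))"
    by (rule linear_maps_supported_on[OF bilinear_linear(1)[OF bilinear_poly_mult] subspace_supported_on _ x])
      (simp add: pvar_def mult_single single_add_monomials[OF k, unfolded One_nat_def])
next
  fix x i k assume x: "x \<in> supported_on (monomials n (Suc i))"
  show "pdiff k x \<in> supported_on (monomials n i)"
  proof (rule linear_maps_supported_on[OF linear_pdiff subspace_supported_on _ x])
    fix \<alpha> assume \<alpha>: "\<alpha> \<in> monomials n (Suc i)"
    show "pdiff k (bvec \<alpha>) \<in> supported_on (monomials n i)"
    proof (cases "Poly_Mapping.lookup \<alpha> k = 0")
      case True
      then show ?thesis
        by (simp add: pdiff_bvec supported_on_def)
    next
      case False
      then have "k \<in> {1..n}"
        using \<alpha> unfolding monomials_iff by (meson in_keys_iff subsetD)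
      then have "\<alpha> - Poly_Mapping.single k 1 \<in> monomials n i"
        using \<alpha> single_add_monomials[of k n "\<alpha> - Poly_Mapping.single k 1" i] single_add_diff[OF False]
        by simp
      then show ?thesis
        by (simp add: pdiff_bvec supported_on_def)
    qed
  qed
next
  fix x k assume x: "x \<in> supported_on (monomials n 0)"
  show "pdiff k x = 0"
    by (rule linear_eq_supported_on[OF linear_pdiff linear_zero _ x])
      (simp add: monomials_0 pdiff_one)
next
  fix x i assume x: "x \<in> supported_on (monomials n i)"
  show "(\<Sum>k = 1..n. pvar k * pdiff k x) = real i *\<^sub>R x"
  proof (rule linear_eq_supported_on[OF _ _ _ x])
    show "linear (\<lambda>x. \<Sum>k = 1..n. pvar k * pdiff k x)"
      by (intro linear_compose_sum ballI linear_compose[OF linear_pdiff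
            bilinear_linear(1)[OF bilinear_poly_mult], unfolded o_def])
    show "linear (\<lambda>x. real i *\<^sub>R x)"
      by (simp add: linear_iff scaleR_add_right)
    fix \<alpha> assume "\<alpha> \<in> monomials n i"
    then have "i = (\<Sum>k = 1..n. Poly_Mapping.lookup \<alpha> k)"
      by (simp add: monomials_iff)
    then show "(\<Sum>k = 1..n. pvar k * pdiff k (bvec \<alpha>)) = real i *\<^sub>R bvec \<alpha>"
      by (simp add: pvar_mult_pdiff_bvec scaleR_sum_left)
  qed
next
  show "poly_pair (pvar k * x) y = poly_pair x (pdiff k y)" for k x y
    unfolding poly_pair_def mult.commute[of "pvar k"] diff_act_mult diff_act_pvar ..
  show "poly_pair (bvec 0) (bvec 0) = 1"
    by (simp add: poly_pair_def diff_act_one lookup_one)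
qed (simp_all add: monomials_0 bilinear_linear(1)[OF bilinear_poly_mult] linear_pdiff pdiff_mult
    pdiff_pvar bilinear_poly_pair linear_poly_perm poly_perm_mult poly_perm_pvar poly_perm_one)

section \<open>The exterior oscillator\<close>

definition subsets_of_card :: "nat \<Rightarrow> nat \<Rightarrow> nat set set" where
  "subsets_of_card n i = {S. S \<subseteq> {1..n} \<and> card S = i}"

lemma ext_deg_eq: "ext_deg n i = supported_on (subsets_of_card n i)"
  by (auto simp: ext_deg_def supported_on_def subsets_of_card_def)

lemma subsets_of_card_finite: "S \<in> subsets_of_card n i \<Longrightarrow> finite S"
  by (auto simp: subsets_of_card_def intro: finite_subset)

lemma subsets_of_card_0: "subsets_of_card n 0 = {{}}"
proof -
  have "S = {}" if "S \<in> subsets_of_card n 0" for S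
    using subsets_of_card_finite[OF that] that by (simp add: subsets_of_card_def)
  then show ?thesis
    by (auto simp: subsets_of_card_def)
qed

lemma egen_ext_deg: "k \<in> {1..n} \<Longrightarrow> egen k \<in> ext_deg n 1"
  by (simp add: egen_def ext_deg_def)

lemma wedge_egen_egen:
  assumes "finite_keys a"
  shows "wedge (egen k) (wedge (egen l) a) = - wedge (egen l) (wedge (egen k) a)"
proof -
  have fin: "finite_keys (egen j)" for j
    by (simp add: egen_def)
  have "wedge (egen k) (egen l) = - wedge (egen l) (egen k)"
    by (auto simp: egen_def wedge_single insert_commute single_uminus[symmetric])
  then have "wedge (wedge (egen k) (egen l)) a = - wedge (wedge (egen l) (egen k)) a"
    by (simp add: linear_neg[OF bilinear_linear(2)[OF bilinear_wedge]])
  then show ?thesis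
    by (simp only: wedge_assoc[OF fin fin assms])
qed

definition wedge_egens :: "nat list \<Rightarrow> ext" where
  "wedge_egens ks = wedge_list (map egen ks)"

lemma wedge_egens_Cons: "wedge_egens (k # ks) = wedge (egen k) (wedge_egens ks)"
  by (simp add: wedge_egens_def wedge_list_def)

lemma wedge_egens_ext_deg: "set ks \<subseteq> {1..n} \<Longrightarrow> wedge_egens ks \<in> ext_deg n (length ks)"
  using ext_deg_wedge_list[of "map egen ks" n] egen_ext_deg
  by (fastforce simp: wedge_egens_def simp del: One_nat_def)

lemma finite_keys_wedge_egens: "set ks \<subseteq> {1..n} \<Longrightarrow> finite_keys (wedge_egens ks)"
  using wedge_egens_ext_deg ext_deg_finite_keys by blast

lemma wedge_egens_repeated:
  "set ks \<subseteq> {1..n} \<Longrightarrow> k \<in> set ks \<Longrightarrow> wedge_egens (k # ks) = 0"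
proof (induction ks)
  case (Cons l ks)
  have fin: "finite_keys (wedge_egens ks)"
    using Cons.prems by (intro finite_keys_wedge_egens[of _ n]) auto
  show ?case
  proof (cases "k = l")
    case True
    have "(2::real) *\<^sub>R wedge_egens (k # l # ks) = 0"
      using wedge_egen_egen[OF fin, of k l] True
      by (simp only: wedge_egens_Cons scaleR_2) (simp add: eq_neg_iff_add_eq_0)
    then show ?thesis
      by simp
  next
    case False
    then have "wedge_egens (k # ks) = 0"
      using Cons by auto
    then show ?thesis
      using wedge_egen_egen[OF fin, of k l] bilinear_rzero[OF bilinear_wedge]
      by (simp add: wedge_egens_Cons)
  qed
qed simp

text \<open>
  Sorting \<open>k\<close> into its place moves it past the smaller elements of \<open>ks\<close>. The map \<open>g\<close>, later a
  permutation of the indices, is applied after sorting and need not respect the order.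
\<close>

lemma wedge_egens_insort:
  assumes g: "\<And>j. j \<in> set ks \<Longrightarrow> g j \<in> {1..n}"
    and "sorted ks" "distinct ks" "k \<notin> set ks"
  shows "wedge_egens (map g (insort k ks))
    = (-1) ^ card {t \<in> set ks. t < k} *\<^sub>R wedge_egens (map g (k # ks))"
  using assms
proof (induction ks)
  case (Cons l ks)
  have fin: "finite_keys (wedge_egens (map g ks))"
    using Cons.prems by (intro finite_keys_wedge_egens[of _ n]) auto
  show ?case
  proof (cases "k \<le> l")
    case True
    then have "{t \<in> set (l # ks). t < k} = {}"
      using Cons.prems(2) by auto
    then have card: "card {t \<in> set (l # ks). t < k} = 0"
      by (simp only: card.empty)
    show ?thesis
      unfolding card using True by simp
  next
    case False
    then have "{t \<in> set (l # ks). t < k} = insert l {t \<in> set ks. t < k}"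
      by auto
    moreover have "l \<notin> {t \<in> set ks. t < k}"
      using Cons.prems(3) by simp
    ultimately have card: "card {t \<in> set (l # ks). t < k} = Suc (card {t \<in> set ks. t < k})"
      by simp
    have IH: "wedge_egens (map g (insort k ks))
        = (-1) ^ card {t \<in> set ks. t < k} *\<^sub>R wedge_egens (map g (k # ks))"
      using Cons by simp
    have "wedge_egens (map g (insort k (l # ks)))
        = wedge (egen (g l)) (wedge_egens (map g (insort k ks)))"
      using False by (simp add: wedge_egens_Cons)
    also have "\<dots> = (-1) ^ card {t \<in> set ks. t < k} *\<^sub>R
        wedge (egen (g l)) (wedge (egen (g k)) (wedge_egens (map g ks)))"
      by (simp add: IH wedge_egens_Cons linear_scale[OF bilinear_linear(1)[OF bilinear_wedge]])
    also have "\<dots> = (-1) ^ card {t \<in> set (l # ks). t < k} *\<^sub>R wedge_egens (map g (k # l # ks))"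
      unfolding card wedge_egen_egen[OF fin, of "g l"] by (simp add: wedge_egens_Cons)
    finally show ?thesis .
  qed
qed simp

lemma ext_perm_bvec: "ext_perm \<sigma> (bvec S) = wedge_egens (map \<sigma> (sorted_list_of_set S))"
  by (simp add: ext_perm_def wedge_egens_def o_def)

text \<open>
  The sign that \<open>wedge\<close> produces when \<open>k\<close> is sorted into \<open>S\<close> is the same as the one that
  \<open>wedge_egens_insort\<close> produces for the images under \<open>\<sigma>\<close>, so the two cancel.
\<close>

lemma ext_perm_wedge_egen:
  assumes \<sigma>: "\<sigma> permutes {1..n}" and x: "x \<in> ext_deg n i"
  shows "ext_perm \<sigma> (wedge (egen k) x) = wedge (egen (\<sigma> k)) (ext_perm \<sigma> x)"
proof (rule linear_eq_supported_on[OF _ _ _ x[unfolded ext_deg_eq]])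
  show "linear (\<lambda>x. ext_perm \<sigma> (wedge (egen k) x))"
    by (rule linear_compose[OF bilinear_linear(1)[OF bilinear_wedge] linear_ext_perm, unfolded o_def])
  show "linear (\<lambda>x. wedge (egen (\<sigma> k)) (ext_perm \<sigma> x))"
    by (rule linear_compose[OF linear_ext_perm bilinear_linear(1)[OF bilinear_wedge], unfolded o_def])
  fix S assume S: "S \<in> subsets_of_card n i"
  have fin: "finite S"
    by (rule subsets_of_card_finite[OF S])
  have range: "\<sigma> j \<in> {1..n}" if "j \<in> S" for j
    using S that permutes_in_image[OF \<sigma>] unfolding subsets_of_card_def by blast
  let ?ks = "sorted_list_of_set S"
  show "ext_perm \<sigma> (wedge (egen k) (bvec S)) = wedge (egen (\<sigma> k)) (ext_perm \<sigma> (bvec S))"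
  proof (cases "k \<in> S")
    case True
    have "wedge_egens (\<sigma> k # map \<sigma> ?ks) = 0"
      using True fin range by (intro wedge_egens_repeated[of _ n]) auto
    then show ?thesis
      using True by (simp add: ext_perm_bvec wedge_egens_Cons egen_def wedge_single
          linear_0[OF linear_ext_perm])
  next
    case False
    let ?s = "(-1) ^ card {t \<in> S. t < k} :: real"
    have "wedge (egen k) (bvec S) = ?s *\<^sub>R bvec (insert k S)"
      using False by (simp add: egen_def wedge_single scaleR_single card_inversions_singleton)
    then have "ext_perm \<sigma> (wedge (egen k) (bvec S)) = ?s *\<^sub>R wedge_egens (map \<sigma> (insort k ?ks))"
      using False fin by (simp add: linear_scale[OF linear_ext_perm] ext_perm_bvec)
    also have "wedge_egens (map \<sigma> (insort k ?ks)) = ?s *\<^sub>R wedge_egens (map \<sigma> (k # ?ks))"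
      using wedge_egens_insort[of ?ks \<sigma> n k] False fin range by simp
    finally show ?thesis
      by (simp add: ext_perm_bvec wedge_egens_Cons flip: power_mult_distrib)
  qed
qed

lemma wedge_egen_int_prod_bvec:
  "wedge (egen k) (int_prod k (bvec S)) = (if k \<in> S then bvec S else 0)"
proof (cases "k \<in> S")
  case True
  then have "inversions {k} (S - {k}) = inversions {k} S" "insert k S = S"
    by (auto simp: inversions_def)
  then show ?thesis
    using True by (simp add: int_prod_single egen_def wedge_single flip: power_mult_distrib)
qed (simp add: int_prod_single bilinear_rzero[OF bilinear_wedge])

lemma ext_oscillator:
  "oscillator n (-1) (subsets_of_card n) {} (\<lambda>k. wedge (egen k)) int_prod ext_pair ext_perm"
proof (rule oscillator.intro)
  show "subsets_of_card n 0 = {{}}"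
    by (rule subsets_of_card_0)
  show "wedge (egen k) x \<in> supported_on (subsets_of_card n (Suc i))"
    if "k \<in> {1..n}" "x \<in> supported_on (subsets_of_card n i)" for k x i
    using ext_deg_wedge[OF egen_ext_deg, of k n x i] that by (simp add: ext_deg_eq)
next
  fix x i k assume x: "x \<in> supported_on (subsets_of_card n (Suc i))"
  show "int_prod k x \<in> supported_on (subsets_of_card n i)"
  proof (rule linear_maps_supported_on[OF linear_int_prod subspace_supported_on _ x])
    fix S assume S: "S \<in> subsets_of_card n (Suc i)"
    then have "k \<in> S \<Longrightarrow> S - {k} \<in> subsets_of_card n i"
      using subsets_of_card_finite[OF S] by (auto simp: subsets_of_card_def)
    then show "int_prod k (bvec S) \<in> supported_on (subsets_of_card n i)"
      by (simp add: int_prod_single supported_on_def)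
  qed
next
  fix x k assume x: "x \<in> supported_on (subsets_of_card n 0)"
  show "int_prod k x = 0"
    by (rule linear_eq_supported_on[OF linear_int_prod linear_zero _ x])
      (simp add: subsets_of_card_0 int_prod_scalar)
next
  fix k l x i assume kl: "k \<in> {1..n}" "l \<in> {1..n}" and x: "x \<in> supported_on (subsets_of_card n i)"
  show "int_prod k (wedge (egen l) x) = - 1 *\<^sub>R wedge (egen l) (int_prod k x) + (if k = l then x else 0)"
    using int_prod_wedge[OF egen_ext_deg[OF kl(2)] x[folded ext_deg_eq], of k]
    by (simp add: int_prod_egen wedge_one_left bilinear_lzero[OF bilinear_wedge])
next
  fix x i assume x: "x \<in> supported_on (subsets_of_card n i)"
  show "(\<Sum>k = 1..n. wedge (egen k) (int_prod k x)) = real i *\<^sub>R x"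
  proof (rule linear_eq_supported_on[OF _ _ _ x])
    show "linear (\<lambda>x. \<Sum>k = 1..n. wedge (egen k) (int_prod k x))"
      by (intro linear_compose_sum ballI linear_compose[OF linear_int_prod
            bilinear_linear(1)[OF bilinear_wedge], unfolded o_def])
    show "linear (\<lambda>x. real i *\<^sub>R x)"
      by (simp add: linear_iff scaleR_add_right)
    fix S assume "S \<in> subsets_of_card n i"
    then have S: "{1..n} \<inter> S = S" "card S = i"
      by (auto simp: subsets_of_card_def)
    have "(\<Sum>k = 1..n. wedge (egen k) (int_prod k (bvec S))) = (\<Sum>k\<in>{1..n} \<inter> S. bvec S)"
      unfolding wedge_egen_int_prod_bvec by (rule sum.inter_restrict[symmetric]) simp
    also have "\<dots> = real i *\<^sub>R bvec S"
      using S by (simp add: sum_constant_scaleR del: sum_constant)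
    finally show "(\<Sum>k = 1..n. wedge (egen k) (int_prod k (bvec S))) = real i *\<^sub>R bvec S" .
  qed
next
  fix k x i y
  assume x: "x \<in> supported_on (subsets_of_card n i)"
    and y: "y \<in> supported_on (subsets_of_card n (Suc i))"
  have "finite_keys x" "finite_keys y"
    by (rule ext_deg_finite_keys[OF x[folded ext_deg_eq]] ext_deg_finite_keys[OF y[folded ext_deg_eq]])+
  then show "ext_pair (wedge (egen k) x) y = ext_pair x (int_prod k y)"
    by (rule ext_pair_wedge_egen)
next
  fix \<sigma> k x i
  assume "\<sigma> permutes {1..n}" "x \<in> supported_on (subsets_of_card n i)"
  then show "ext_perm \<sigma> (wedge (egen k) x) = wedge (egen (\<sigma> k)) (ext_perm \<sigma> x)"
    by (intro ext_perm_wedge_egen[of \<sigma> n x i]) (simp_all only: ext_deg_eq)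
next
  show "ext_perm \<sigma> (bvec {}) = bvec {}" for \<sigma>
    by (simp add: ext_perm_bvec wedge_egens_def wedge_list_def)
qed (simp_all add: bilinear_linear(1)[OF bilinear_wedge] linear_int_prod bilinear_ext_pair
    ext_pair_bvec linear_ext_perm)

text \<open>
  This is the reason for the shift \<open>s = m - n\<close> when \<open>m > n\<close>: the sign of the pairing comes from
  \<open>2 n - m\<close>, that of the swap from \<open>m\<close>. Writing \<open>m = n + t\<close>, both binomial coefficients agree for
  \<open>t = 0\<close>, and the parity of their sum changes whenever \<open>t\<close> increases by one and \<open>2 n - m\<close> is kept.
\<close>

lemma minus_one_power_choose_two_reflect:
  assumes "n < m" "m \<le> 2 * n"
  shows "(-1) ^ ((2 * n - m) choose 2) * (-1) ^ (m choose 2) = ((-1) ^ (m - n) :: real)"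
proof -
  have *: "(-1) ^ (u choose 2) * (-1) ^ ((2 * t + u) choose 2) = ((-1) ^ t :: real)" for u t
  proof (induction t)
    case (Suc t)
    have "(2 * Suc t + u) choose 2 = 2 * (2 * t + u) + 1 + ((2 * t + u) choose 2)"
      by (simp add: numeral_2_eq_2)
    then show ?case
      using Suc by (simp add: power_add power_mult)
  qed (simp flip: power_mult_distrib)
  have "2 * (m - n) + (2 * n - m) = m"
    using assms by simp
  then show ?thesis
    using *[of "2 * n - m" "m - n"] by simp
qed

theorem theorem1:
  fixes n m :: nat
  assumes "n \<ge> 1"
  shows
    "(poincare_duality n (poly_H n m) poly_act poly_form \<and>
      hard_lefschetz n (poly_H n m) poly_act (poly_L n) \<and>
      hodge_riemann n m 0 (poly_H n m) poly_act poly_form (poly_L n)) \<and>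
     (m \<le> 2 * n \<longrightarrow>
      poincare_duality n (ext_H n m) ext_act (ext_form n m) \<and>
      hard_lefschetz n (ext_H n m) ext_act (ext_L n) \<and>
      hodge_riemann n m (max 0 (int m - int n)) (ext_H n m) ext_act (ext_form n m) (ext_L n))"
proof (intro conjI impI)
  interpret P: oscillator n 1 "monomials n" 0 "\<lambda>k d. pvar k * d" pdiff poly_pair poly_perm
    by (rule poly_oscillator)
  have "poly_hom n = P.A"
    by (rule HOL.ext) (rule poly_hom_eq)
  then have P1: "poly_H n m = P.piece m"
    unfolding poly_H_def P.piece_def by (rule arg_cong)
  have P2: "poly_act = P.act"
    by (intro HOL.ext) (simp only: poly_act_def P.act_def)
  have P3: "poly_form = (\<lambda>x y. 1 * P.form x y)"
    by (intro HOL.ext) (simp only: poly_form_def P.form_def mult_1)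
  have P4: "poly_L n = P.L"
    by (intro HOL.ext) (simp only: poly_L_def P.L_def)
  note P = P1 P2 P3 P4
  show "poincare_duality n (poly_H n m) poly_act poly_form"
    unfolding P by (rule P.poincare_duality) simp
  show "hard_lefschetz n (poly_H n m) poly_act (poly_L n)"
    unfolding P by (rule P.hard_lefschetz)
  show "hodge_riemann n m 0 (poly_H n m) poly_act poly_form (poly_L n)"
    unfolding P by (rule P.hodge_riemann) simp
next
  assume m: "m \<le> 2 * n"
  interpret E: oscillator n "-1" "subsets_of_card n" "{}" "\<lambda>k. wedge (egen k)" int_prod ext_pair ext_perm
    by (rule ext_oscillator)
  define c :: real where "c = (-1) ^ ((if m \<le> n then m else 2 * n - m) choose 2)"
  have c: "c = (-1) ^ (if m \<le> n then m * (m - 1) div 2 else (2 * n - m) * (2 * n - m - 1) div 2)"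
    by (cases "m \<le> n") (simp_all only: c_def choose_two if_True if_False)
  have "ext_deg n = E.A"
    by (rule HOL.ext) (rule ext_deg_eq)
  then have E1: "ext_H n m = E.piece m"
    unfolding ext_H_def E.piece_def by (rule arg_cong)
  have E2: "ext_act = E.act"
    by (intro HOL.ext) (simp only: ext_act_def E.act_def)
  have E3: "ext_form n m = (\<lambda>x y. c * E.form x y)"
    unfolding ext_form_def E.form_def c by (rule refl)
  have E4: "ext_L n = E.L"
    unfolding ext_L_def[abs_def] E.L_def[abs_def] by (rule refl)
  note E = E1 E2 E3 E4
  show "poincare_duality n (ext_H n m) ext_act (ext_form n m)"
    unfolding E by (rule E.poincare_duality) (simp add: c_def)
  show "hard_lefschetz n (ext_H n m) ext_act (ext_L n)"
    unfolding E by (rule E.hard_lefschetz)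
  show "hodge_riemann n m (max 0 (int m - int n)) (ext_H n m) ext_act (ext_form n m) (ext_L n)"
    unfolding E
  proof (rule E.hodge_riemann)
    show "c * (-1) ^ (m choose 2) = (-1) powi max 0 (int m - int n)"
    proof (cases "m \<le> n")
      case True
      then show ?thesis
        by (simp add: c_def max_absorb1 flip: power_mult_distrib)
    next
      case False
      then have max: "max 0 (int m - int n) = int (m - n)"
        by simp
      show ?thesis
        unfolding max power_int_of_nat
        using False m minus_one_power_choose_two_reflect[of n m] by (simp add: c_def)
    qed
  qed
qed

end
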